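(* Let $(\mathfrak g,\pi)$ be a finite-dimensional real $3$-Lie algebra and $\mathfrak h\subset\mathfrak g$ a $k$-dimensional $3$-Lie subalgebra of $(\mathfrak g,\pi)$. If $H^2(\mathfrak h,\mathfrak g/\mathfrak h)=0$, then $\mathfrak h$ is a stable subalgebra of $\mathfrak g$.
   Context: A $3$-Lie algebra is a vector space $\mathfrak g$ with a linear map $\pi:\wedge^3\mathfrak g\to\mathfrak g$ such that $\pi(x_1,x_2,\pi(x_3,x_4,x_5))=\pi(\pi(x_1,x_2,x_3),x_4,x_5)+\pi(x_3,\pi(x_1,x_2,x_4),x_5)+\pi(x_3,x_4,\pi(x_1,x_2,x_5))$ for all $x_i\in\mathfrak g$. A $3$-Lie subalgebra is a subspace closed under $\pi$. $\mathrm{Gr}_k(\mathfrak g)$ is the Grassmannian manifold of $k$-dimensional subspaces of $\mathfrak g$. The $k$-dimensional $3$-Lie subalgebra $\mathfrak h$ of $(\mathfrak g,\pi)$ is called stable if for any $3$-Lie algebra structure $\pi'$ on $\mathfrak g$ that is $\mathcal C^0$-close to $\pi$ there exists a $k$-dimensional $3$-Lie subalgebra $\mathfrak h'\subset\mathfrak g$ (of $(\mathfrak g,\pi')$) which is $\mathcal C^0$-close to $\mathfrak h$. That is: for every neighborhood $\mathcal V$ of $\mathfrak h$ in $\mathrm{Gr}_k(\mathfrak g)$ there is a neighborhood $\mathcal W$ of $\pi$ in $\mathrm{Hom}(\wedge^3\mathfrak g,\mathfrak g)$ such that for every $3$-Lie algebra structure $\pi'\in\mathcal W$ there is $\mathfrak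 h'\in\mathcal V$ which is a $3$-Lie subalgebra of $(\mathfrak g,\pi')$. Cohomology: define $\overline{\mathrm{ad}}:\wedge^2\mathfrak h\to\mathrm{Hom}(\mathfrak g/\mathfrak h,\mathfrak g/\mathfrak h)$ by $\overline{\mathrm{ad}}_{u\wedge v}(\bar x)=\overline{\pi(u,v,x)}$, a representation of $\mathfrak h$ on $\mathfrak g/\mathfrak h$; write $\rho(u,v)=\overline{\mathrm{ad}}_{u\wedge v}$. For $n\ge1$, $C^n(\mathfrak h,\mathfrak g/\mathfrak h)=\mathrm{Hom}((\wedge^2\mathfrak h)^{\otimes(n-1)}\wedge\mathfrak h,\mathfrak g/\mathfrak h)$, where $(\wedge^2\mathfrak h)^{\otimes m}\wedge\mathfrak h$ means $\mathfrak h$ for $m=0$ and $(\wedge^2\mathfrak h)^{\otimes(m-1)}\otimes\wedge^3\mathfrak h$ for $m\ge1$. The coboundary $\partial:C^n\to C^{n+1}$ is $$\begin{aligned}\partial(\theta)(x_1\wedge y_1,\dots,x_n\wedge y_n,x_{n+1})=&\sum_{1\le i<j\le n}(-1)^i\theta\big(x_1\wedge y_1,\dots,\widehat{x_i\wedge y_i},\dots,x_{j-1}\wedge y_{j-1},\pi(x_i,y_i,x_j)\wedge y_j+x_j\wedge\pi(x_i,y_i,y_j),\dots,x_n\wedge y_n,x_{n+1}\big)\\&+\sum_{i=1}^n(-1)^i\theta\big(x_1\wedge y_1,\dots,\widehat{x_i\wedge y_i},\dots,x_n\wedge y_n,\pi(x_i,y_i,x_{n+1})\big)\\&+\sum_{i=1}^n(-1)^{i+1}\rho(x_i,y_i)\theta\big(x_1\wedge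 y_1,\dots,\widehat{x_i\wedge y_i},\dots,x_n\wedge y_n,x_{n+1}\big)\\&+(-1)^{n+1}\Big(\rho(y_n,x_{n+1})\theta(x_1\wedge y_1,\dots,x_{n-1}\wedge y_{n-1},x_n)+\rho(x_{n+1},x_n)\theta(x_1\wedge y_1,\dots,x_{n-1}\wedge y_{n-1},y_n)\Big).\end{aligned}$$ $H^2(\mathfrak h,\mathfrak g/\mathfrak h)=\ker(\partial|_{C^2})/\partial(C^1)$. *)

theory Defs
  imports "HOL-Analysis.Analysis"
begin

section \<open>3-Lie algebras\<close>

text \<open>
  A linear map \<open>\<wedge>\<^sup>3 V \<rightarrow> V\<close> is encoded as an alternating trilinear map. The vector space is the whole
  type; finite-dimensionality is a separate assumption, so that the zero space is included. The
  norm of the type serves only to provide the topology, which is the same for all norms in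
  finite dimension.
\<close>

definition finite_dimensional :: "'a::real_vector itself \<Rightarrow> bool" where
  "finite_dimensional _ \<longleftrightarrow> (\<exists>B::'a set. finite B \<and> span B = UNIV)"

definition Hom3 :: "('a::real_vector \<Rightarrow> 'a \<Rightarrow> 'a \<Rightarrow> 'a) set" where
  "Hom3 = {\<pi>. (\<forall>y z. linear (\<lambda>x. \<pi> x y z)) \<and> (\<forall>x z. linear (\<lambda>y. \<pi> x y z)) \<and> (\<forall>x y. linear (\<lambda>z. \<pi> x y z))
             \<and> (\<forall>x y. \<pi> x x y = 0 \<and> \<pi> x y y = 0 \<and> \<pi> x y x = 0)}"

definition three_lie_algebra :: "('a::real_vector \<Rightarrow> 'a \<Rightarrow> 'a \<Rightarrow> 'a) \<Rightarrow> bool" where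
  "three_lie_algebra \<pi> \<longleftrightarrow> \<pi> \<in> Hom3 \<and>
     (\<forall>x1 x2 x3 x4 x5. \<pi> x1 x2 (\<pi> x3 x4 x5) =
        \<pi> (\<pi> x1 x2 x3) x4 x5 + \<pi> x3 (\<pi> x1 x2 x4) x5 + \<pi> x3 x4 (\<pi> x1 x2 x5))"

definition three_lie_subalgebra :: "('a::real_vector \<Rightarrow> 'a \<Rightarrow> 'a \<Rightarrow> 'a) \<Rightarrow> 'a set \<Rightarrow> bool" where
  "three_lie_subalgebra \<pi> h \<longleftrightarrow> subspace h \<and> (\<forall>x\<in>h. \<forall>y\<in>h. \<forall>z\<in>h. \<pi> x y z \<in> h)"

section \<open>Stability\<close>

text \<open>The topology on \<open>Hom(\<wedge>\<^sup>3 V, V)\<close> is that of the operator norm.\<close>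

definition Hom3_topology :: "('a::real_normed_vector \<Rightarrow> 'a \<Rightarrow> 'a \<Rightarrow> 'a) topology" where
  "Hom3_topology = topology (\<lambda>W. W \<subseteq> Hom3 \<and>
     (\<forall>\<pi>\<in>W. \<exists>e>0. \<forall>\<pi>'\<in>Hom3.
        (\<forall>x y z. norm (\<pi>' x y z - \<pi> x y z) \<le> e * norm x * norm y * norm z) \<longrightarrow> \<pi>' \<in> W))"

lemma openin_Hom3_topology:
  "openin Hom3_topology W \<longleftrightarrow> W \<subseteq> Hom3 \<and>
     (\<forall>\<pi>\<in>W. \<exists>e>0. \<forall>\<pi>'\<in>Hom3.
        (\<forall>x y z. norm (\<pi>' x y z - \<pi> x y z) \<le> e * norm x * norm y * norm z) \<longrightarrow> \<pi>' \<in> W)"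
proof -
  define N where "N e \<pi> = {\<pi>'\<in>Hom3. \<forall>x y z. norm (\<pi>' x y z - \<pi> x y z) \<le> e * norm x * norm y * norm z}"
    for e and \<pi> :: "'a \<Rightarrow> 'a \<Rightarrow> 'a \<Rightarrow> 'a"
  have mono: "N d \<pi> \<subseteq> N e \<pi>" if "d \<le> e" for d e \<pi>
  proof -
    have "d * norm x * norm y * norm z \<le> e * norm x * norm y * norm z" for x y z :: 'a
      using that by (intro mult_right_mono) auto
    then show ?thesis unfolding N_def by (blast intro: order_trans)
  qed
  have "istopology (\<lambda>W. W \<subseteq> Hom3 \<and> (\<forall>\<pi>\<in>W. \<exists>e>0. N e \<pi> \<subseteq> W))"
    unfolding istopology_def
  proof (intro conjI allI impI)
    fix S T :: "('a \<Rightarrow> 'a \<Rightarrow> 'a \<Rightarrow> 'a) set"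
    assume S: "S \<subseteq> Hom3 \<and> (\<forall>\<pi>\<in>S. \<exists>e>0. N e \<pi> \<subseteq> S)" and T: "T \<subseteq> Hom3 \<and> (\<forall>\<pi>\<in>T. \<exists>e>0. N e \<pi> \<subseteq> T)"
    show "S \<inter> T \<subseteq> Hom3" using S by blast
    show "\<forall>\<pi>\<in>S \<inter> T. \<exists>e>0. N e \<pi> \<subseteq> S \<inter> T"
    proof
      fix \<pi> assume "\<pi> \<in> S \<inter> T"
      then obtain d e where "d > 0" "N d \<pi> \<subseteq> S" "e > 0" "N e \<pi> \<subseteq> T"
        using S T by blast
      then show "\<exists>e>0. N e \<pi> \<subseteq> S \<inter> T"
        using mono[of "min d e" d \<pi>] mono[of "min d e" e \<pi>] by (intro exI[of _ "min d e"]) auto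
    qed
  next
    fix \<K> :: "('a \<Rightarrow> 'a \<Rightarrow> 'a \<Rightarrow> 'a) set set"
    assume K: "\<forall>K\<in>\<K>. K \<subseteq> Hom3 \<and> (\<forall>\<pi>\<in>K. \<exists>e>0. N e \<pi> \<subseteq> K)"
    show "\<Union>\<K> \<subseteq> Hom3" using K by blast
    show "\<forall>\<pi>\<in>\<Union>\<K>. \<exists>e>0. N e \<pi> \<subseteq> \<Union>\<K>"
    proof
      fix \<pi> assume "\<pi> \<in> \<Union>\<K>"
      then obtain K where "K \<in> \<K>" "\<pi> \<in> K" by blast
      with K obtain e where "e > 0" "N e \<pi> \<subseteq> K" by blast
      then show "\<exists>e>0. N e \<pi> \<subseteq> \<Union>\<K>" using \<open>K \<in> \<K>\<close> by blast
    qed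
  qed
  moreover have "N e \<pi> \<subseteq> W \<longleftrightarrow> (\<forall>\<pi>'\<in>Hom3.
      (\<forall>x y z. norm (\<pi>' x y z - \<pi> x y z) \<le> e * norm x * norm y * norm z) \<longrightarrow> \<pi>' \<in> W)" for e \<pi> W
    unfolding N_def by blast
  ultimately show ?thesis
    unfolding Hom3_topology_def by (simp add: topology_inverse')
qed

definition Gr :: "nat \<Rightarrow> 'a::real_vector set set" where
  "Gr k = {U. subspace U \<and> dim U = k}"

text \<open>
  The Grassmannian carries the quotient topology under the map from the space of linearly
  independent \<open>k\<close>-tuples (as a subspace of the \<open>k\<close>-fold product) to their span.
\<close>

definition frames :: "nat \<Rightarrow> (nat \<Rightarrow> 'a::real_vector) set" where
  "frames k = {v \<in> {..<k} \<rightarrow>\<^sub>E UNIV. inj_on v {..<k} \<and> independent (v ` {..<k})}"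

definition frame_topology :: "nat \<Rightarrow> (nat \<Rightarrow> 'a::real_normed_vector) topology" where
  "frame_topology k = subtopology (product_topology (\<lambda>_. euclidean) {..<k}) (frames k)"

definition Gr_topology :: "nat \<Rightarrow> 'a::real_normed_vector set topology" where
  "Gr_topology k = topology (\<lambda>\<V>. \<V> \<subseteq> Gr k \<and>
     openin (frame_topology k) {v \<in> frames k. span (v ` {..<k}) \<in> \<V>})"

lemma openin_Gr_topology:
  "openin (Gr_topology k) \<V> \<longleftrightarrow> \<V> \<subseteq> Gr k \<and>
     openin (frame_topology k) {v \<in> frames k. span (v ` {..<k}) \<in> \<V>}"
proof -
  have "istopology (\<lambda>\<V>. \<V> \<subseteq> Gr k \<and>
     openin (frame_topology k) {v \<in> frames k. span (v ` {..<k}) \<in> (\<V> :: 'a set set)})"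
    unfolding istopology_def
  proof (intro conjI allI impI)
    fix S T :: "'a set set"
    assume S: "S \<subseteq> Gr k \<and> openin (frame_topology k) {v \<in> frames k. span (v ` {..<k}) \<in> S}"
      and T: "T \<subseteq> Gr k \<and> openin (frame_topology k) {v \<in> frames k. span (v ` {..<k}) \<in> T}"
    show "S \<inter> T \<subseteq> Gr k" using S by blast
    have "{v \<in> frames k. span (v ` {..<k}) \<in> S \<inter> T} =
        {v \<in> frames k. span (v ` {..<k}) \<in> S} \<inter> {v \<in> frames k. span (v ` {..<k}) \<in> T}"
      by blast
    then show "openin (frame_topology k) {v \<in> frames k. span (v ` {..<k}) \<in> S \<inter> T}"
      using S T by (simp add: openin_Int)
  next
    fix \<K> :: "'a set set set"
    assume K: "\<forall>K\<in>\<K>. K \<subseteq> Gr k \<and> openin (frame_topology k) {v \<in> frames k. span (v ` {..<k}) \<in> K}"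
    show "\<Union>\<K> \<subseteq> Gr k" using K by blast
    have "{v \<in> frames k. span (v ` {..<k}) \<in> \<Union>\<K>} =
        (\<Union>K\<in>\<K>. {v \<in> frames k. span (v ` {..<k}) \<in> K})"
      by blast
    then show "openin (frame_topology k) {v \<in> frames k. span (v ` {..<k}) \<in> \<Union>\<K>}"
      using K by auto
  qed
  then show ?thesis
    unfolding Gr_topology_def by (subst topology_inverse') auto
qed

definition stable_subalgebra ::
  "nat \<Rightarrow> ('a::real_normed_vector \<Rightarrow> 'a \<Rightarrow> 'a \<Rightarrow> 'a) \<Rightarrow> 'a set \<Rightarrow> bool" where
  "stable_subalgebra k \<pi> h \<longleftrightarrow>
     (\<forall>\<V>. openin (Gr_topology k) \<V> \<and> h \<in> \<V> \<longrightarrow>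
       (\<exists>\<W>. openin Hom3_topology \<W> \<and> \<pi> \<in> \<W> \<and>
         (\<forall>\<pi>'\<in>\<W>. three_lie_algebra \<pi>' \<longrightarrow> (\<exists>h'\<in>\<V>. three_lie_subalgebra \<pi>' h'))))"

section \<open>Cohomology with values in the quotient by a subalgebra\<close>

text \<open>
  Elements of the quotient by \<open>h\<close> are the cosets \<open>x +o h\<close>, and \<open>+\<close> on cosets is the elementwise sum of
  sets from \<^theory>\<open>HOL-Library.Set_Algebras\<close>. The zero of the quotient is the coset \<open>h\<close>, whereas an
  empty sum of sets is \<open>{0}\<close>; this makes no difference once it is added to a coset. In
  \<open>quot_scale\<close> the summand \<open>h\<close> matters only for \<open>c = 0\<close>; in \<open>ad_bar\<close> it is needed as the image of
  a coset under \<open>\<pi> u v\<close> need not be a full coset.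
\<close>

definition quot :: "'a::real_vector set \<Rightarrow> 'a set set" where
  "quot h = range (\<lambda>x. x +o h)"

definition quot_scale :: "'a::real_vector set \<Rightarrow> real \<Rightarrow> 'a set \<Rightarrow> 'a set" where
  "quot_scale h c A = (\<lambda>a. c *\<^sub>R a) ` A + h"

definition ad_bar :: "('a::real_vector \<Rightarrow> 'a \<Rightarrow> 'a \<Rightarrow> 'a) \<Rightarrow> 'a set \<Rightarrow> 'a \<Rightarrow> 'a \<Rightarrow> 'a set \<Rightarrow> 'a set" where
  "ad_bar \<pi> h u v A = \<pi> u v ` A + h"

lemma quot_operations:
  assumes "subspace h"
  shows "(x +o h) + (y +o h) = (x + y) +o h"
    and "quot_scale h c (x +o h) = (c *\<^sub>R x) +o h"
    and "three_lie_algebra \<pi> \<Longrightarrow> three_lie_subalgebra \<pi> h \<Longrightarrow> u \<in> h \<Longrightarrow> v \<in> h \<Longrightarrow>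
           ad_bar \<pi> h u v (x +o h) = \<pi> u v x +o h"
proof -
  have hh: "h + h = h"
  proof
    show "h + h \<subseteq> h" using subspace_add[OF assms] by (auto simp: set_plus_def)
    show "h \<subseteq> h + h" using set_plus_intro[OF subspace_0[OF assms], of _ h] by auto
  qed
  have elt_set_plus_image: "x +o A = (+) x ` A" for x :: 'a and A
    by (auto simp: elt_set_plus_def)
  show "(x +o h) + (y +o h) = (x + y) +o h"
    by (simp add: set_plus_rearrange hh)
  have im: "f ` (x +o h) + h = f x +o h" if "linear f" "f ` h \<subseteq> h" for f
  proof -
    have "f ` (x +o h) = f x +o (f ` h)"
      using linear_add[OF that(1)] by (simp add: elt_set_plus_image image_image)
    moreover have "f ` h + h = h"
    proof
      show "f ` h + h \<subseteq> h" using that(2) assms by (auto simp: set_plus_def intro!: subspace_add)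
      have "0 \<in> f ` h"
        using linear_0[OF that(1)] subspace_0[OF assms] by (metis imageI)
      then show "h \<subseteq> f ` h + h"
        using set_plus_intro[of 0 "f ` h" _ h] by auto
    qed
    ultimately show ?thesis by (simp add: set_plus_rearrange3)
  qed
  show "quot_scale h c (x +o h) = (c *\<^sub>R x) +o h"
    unfolding quot_scale_def using assms
    by (intro im) (auto simp: subspace_scale linear_iff scaleR_add_right)
  show "ad_bar \<pi> h u v (x +o h) = \<pi> u v x +o h"
    if "three_lie_algebra \<pi>" "three_lie_subalgebra \<pi> h" "u \<in> h" "v \<in> h"
    unfolding ad_bar_def using that
    by (intro im) (auto simp: three_lie_algebra_def three_lie_subalgebra_def Hom3_def)
qed

definition linear_to_quot :: "'a::real_vector set \<Rightarrow> ('a \<Rightarrow> 'a set) \<Rightarrow> bool" where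
  "linear_to_quot h f \<longleftrightarrow>
     (\<forall>u\<in>h. \<forall>v\<in>h. f (u + v) = f u + f v) \<and> (\<forall>c. \<forall>u\<in>h. f (c *\<^sub>R u) = quot_scale h c (f u))"

text \<open>
  An \<open>n\<close>-cochain takes the pairs \<open>(x\<^sub>1, y\<^sub>1), \<dots>, (x\<^bsub>n-1\<^esub>, y\<^bsub>n-1\<^esub>)\<close> as a list, and then \<open>x\<^sub>n\<close>. A linear map on
  \<open>(\<wedge>\<^sup>2 h)\<^bsup>\<otimes>(n-2)\<^esup> \<otimes> \<wedge>\<^sup>3 h\<close> amounts to a multilinear map that is alternating in each pair and in the
  last three arguments, for which it suffices that it vanishes if two neighbours among
  \<open>x\<^bsub>n-1\<^esub>, y\<^bsub>n-1\<^esub>, x\<^sub>n\<close> agree. Cochains are extensional, hence equal if they agree on \<open>h\<close>.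
\<close>

definition cochain_args :: "'a set \<Rightarrow> nat \<Rightarrow> (('a \<times> 'a) list \<times> 'a) set" where
  "cochain_args h n = {(ps, z). length ps = n - 1 \<and> set ps \<subseteq> h \<times> h \<and> z \<in> h}"

definition cochains :: "'a::real_vector set \<Rightarrow> nat \<Rightarrow> (('a \<times> 'a) list \<times> 'a \<Rightarrow> 'a set) set" where
  "cochains h n = {\<theta> \<in> cochain_args h n \<rightarrow>\<^sub>E quot h. \<forall>(ps, z) \<in> cochain_args h n.
     linear_to_quot h (\<lambda>u. \<theta> (ps, u)) \<and>
     (\<forall>i < n - 1.
        linear_to_quot h (\<lambda>u. \<theta> (ps[i := (u, snd (ps ! i))], z)) \<and>
        linear_to_quot h (\<lambda>u. \<theta> (ps[i := (fst (ps ! i), u)], z)) \<and>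
        (fst (ps ! i) = snd (ps ! i) \<longrightarrow> \<theta> (ps, z) = h)) \<and>
     (ps \<noteq> [] \<and> snd (last ps) = z \<longrightarrow> \<theta> (ps, z) = h)}"

definition zero_cochain :: "'a set \<Rightarrow> nat \<Rightarrow> ('a \<times> 'a) list \<times> 'a \<Rightarrow> 'a set" where
  "zero_cochain h n = restrict (\<lambda>_. h) (cochain_args h n)"

definition cochain_add :: "'a::real_vector set \<Rightarrow> nat \<Rightarrow> (('a \<times> 'a) list \<times> 'a \<Rightarrow> 'a set) \<Rightarrow>
    (('a \<times> 'a) list \<times> 'a \<Rightarrow> 'a set) \<Rightarrow> ('a \<times> 'a) list \<times> 'a \<Rightarrow> 'a set" where
  "cochain_add h n \<theta> \<eta> = restrict (\<lambda>a. \<theta> a + \<eta> a) (cochain_args h n)"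

text \<open>
  Indices run from 1 as in \<open>x\<^sub>1, \<dots>, x\<^sub>n\<close>, while list positions run from 0. In the double sum the entry
  \<open>\<pi>(x\<^sub>i, y\<^sub>i, x\<^sub>j) \<wedge> y\<^sub>j + x\<^sub>j \<wedge> \<pi>(x\<^sub>i, y\<^sub>i, y\<^sub>j)\<close> is not a pair, so the value of \<open>\<theta>\<close> is expanded by linearity.
\<close>

definition omit :: "nat \<Rightarrow> 'b list \<Rightarrow> 'b list" where
  "omit i ps = take (i - 1) ps @ drop i ps"

definition coboundary :: "('a::real_vector \<Rightarrow> 'a \<Rightarrow> 'a \<Rightarrow> 'a) \<Rightarrow> 'a set \<Rightarrow> nat \<Rightarrow>
    (('a \<times> 'a) list \<times> 'a \<Rightarrow> 'a set) \<Rightarrow> ('a \<times> 'a) list \<times> 'a \<Rightarrow> 'a set" where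
  "coboundary \<pi> h n \<theta> = restrict (\<lambda>(ps, z).
     let x = (\<lambda>i. fst (ps ! (i - 1))); y = (\<lambda>i. snd (ps ! (i - 1)));
         \<rho> = ad_bar \<pi> h; scale = quot_scale h
     in (\<Sum>j\<in>{1..n}. \<Sum>i\<in>{1..<j}. scale ((-1) ^ i)
            (\<theta> (omit i (ps[j - 1 := (\<pi> (x i) (y i) (x j), y j)]), z) +
             \<theta> (omit i (ps[j - 1 := (x j, \<pi> (x i) (y i) (y j))]), z)))
      + (\<Sum>i\<in>{1..n}. scale ((-1) ^ i) (\<theta> (omit i ps, \<pi> (x i) (y i) z)))
      + (\<Sum>i\<in>{1..n}. scale ((-1) ^ (i + 1)) (\<rho> (x i) (y i) (\<theta> (omit i ps, z))))
      + scale ((-1) ^ (n + 1))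
          (\<rho> (y n) z (\<theta> (butlast ps, x n)) + \<rho> z (x n) (\<theta> (butlast ps, y n))))
     (cochain_args h (n + 1))"

definition cocycles :: "('a::real_vector \<Rightarrow> 'a \<Rightarrow> 'a \<Rightarrow> 'a) \<Rightarrow> 'a set \<Rightarrow> nat \<Rightarrow>
    (('a \<times> 'a) list \<times> 'a \<Rightarrow> 'a set) set" where
  "cocycles \<pi> h n = {\<theta> \<in> cochains h n. coboundary \<pi> h n \<theta> = zero_cochain h (n + 1)}"

text \<open>The following definitions are meant for \<open>n \<ge> 2\<close>, as cochains start in degree 1.\<close>

definition coboundaries :: "('a::real_vector \<Rightarrow> 'a \<Rightarrow> 'a \<Rightarrow> 'a) \<Rightarrow> 'a set \<Rightarrow> nat \<Rightarrow>
    (('a \<times> 'a) list \<times> 'a \<Rightarrow> 'a set) set" where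
  "coboundaries \<pi> h n = coboundary \<pi> h (n - 1) ` cochains h (n - 1)"

definition cohomology :: "('a::real_vector \<Rightarrow> 'a \<Rightarrow> 'a \<Rightarrow> 'a) \<Rightarrow> 'a set \<Rightarrow> nat \<Rightarrow>
    (('a \<times> 'a) list \<times> 'a \<Rightarrow> 'a set) set set" where
  "cohomology \<pi> h n = cocycles \<pi> h n //
     {(\<theta>, \<theta>'). \<theta> \<in> cocycles \<pi> h n \<and> \<theta>' \<in> cocycles \<pi> h n \<and>
        (\<exists>\<beta>\<in>coboundaries \<pi> h n. \<theta>' = cochain_add h n \<theta> \<beta>)}"

text \<open>The zero class is the set of all coboundaries.\<close>

definition cohomology_vanishes :: "('a::real_vector \<Rightarrow> 'a \<Rightarrow> 'a \<Rightarrow> 'a) \<Rightarrow> 'a set \<Rightarrow> nat \<Rightarrow> bool" where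
  "cohomology_vanishes \<pi> h n \<longleftrightarrow> cohomology \<pi> h n = {coboundaries \<pi> h n}"

end

theory Submission
  imports Defs
begin


text \<open>
  For \<open>\<phi>\<close> with \<open>\<phi> \<circ> \<phi> = 0\<close>, the subspace \<open>(1 + \<phi>) h\<close> is a subalgebra of \<open>(\<gg>, \<pi>')\<close> if and only if \<open>h\<close> is a
  subalgebra for the pulled back structure \<open>\<sigma> = (1 - \<phi>) \<circ> \<pi>' \<circ> (1 + \<phi>)\<^sup>3\<close>, that is, if the class \<open>\<omega>\<close> of
  \<open>\<sigma>\<close> in \<open>Hom(\<wedge>\<^sup>3 h, \<gg>/h)\<close> vanishes. The derivative of \<open>\<omega>\<close> in \<open>\<phi>\<close> at \<open>(\<pi>, 0)\<close> is the coboundary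
  \<open>C\<^sup>1 \<rightarrow> C\<^sup>2\<close>, so for \<open>\<pi>'\<close> close to \<open>\<pi>\<close> a contraction argument yields a small \<open>\<phi>\<close> such that \<open>\<omega>\<close> lies in
  a fixed complement of its image. The fundamental identity for \<open>\<sigma>\<close> is a linear equation for \<open>\<omega>\<close>
  whose coefficients depend on \<open>\<sigma>\<close> and which for \<open>\<sigma> = \<pi>\<close> is the cocycle condition. As the second
  cohomology vanishes, this equation has no nonzero solution in the complement for \<open>\<sigma> = \<pi>\<close>, hence, by
  compactness of the unit sphere, none for \<open>\<sigma>\<close> close to \<open>\<pi>\<close>. So \<open>\<omega> = 0\<close>.
\<close>

section \<open>Finite-dimensional normed spaces\<close>

text \<open>A convergent sequence is bounded, so it stays in a single ball, where compactness gives
  closedness.\<close>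

lemma closed_if_compact_Int_cball:
  fixes S :: "'a::real_normed_vector set"
  assumes "\<And>r. compact (S \<inter> cball 0 r)"
  shows "closed S"
  unfolding closed_sequential_limits
proof (intro allI impI, elim conjE)
  fix x l assume x: "\<forall>n. x n \<in> S" "x \<longlonglongrightarrow> l"
  obtain r where r: "\<And>n. norm (x n) \<le> r"
    using convergent_imp_Bseq[OF convergentI[OF x(2)]] by (auto simp: Bseq_def)
  have "closed (S \<inter> cball 0 r)"
    using assms compact_imp_closed by blast
  with x r show "l \<in> S"
    unfolding closed_sequential_limits by (metis IntD1 IntI mem_cball_0)
qed

text \<open>The distance from \<open>b\<close> to \<open>S\<close> serves as \<open>d\<close>; it is
  positive because \<open>S\<close> is closed, and dividing by \<open>t\<close> reduces the estimate
  to it. It bounds the coefficient of a new spanning vector in the two inductions below.\<close>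

lemma scaleR_le_norm_add:
  fixes b :: "'a::real_normed_vector"
  assumes "subspace S" "closed S" "b \<notin> S"
  obtains d where "d > 0" "\<And>t y. y \<in> S \<Longrightarrow> d * \<bar>t\<bar> \<le> norm (t *\<^sub>R b + y)"
proof
  define d where "d = infdist b S"
  have ne: "S \<noteq> {}" using subspace_0[OF assms(1)] by auto
  show "d > 0"
    unfolding d_def using assms ne in_closed_iff_infdist_zero infdist_nonneg less_eq_real_def by metis
  show "d * \<bar>t\<bar> \<le> norm (t *\<^sub>R b + y)" if "y \<in> S" for t y
  proof (cases "t = 0")
    case False
    have "(- 1 / t) *\<^sub>R y \<in> S" using subspace_scale[OF assms(1) that] .
    then have "d \<le> dist b ((- 1 / t) *\<^sub>R y)" unfolding d_def by (rule infdist_le)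
    then have "d * \<bar>t\<bar> \<le> norm (b - (- 1 / t) *\<^sub>R y) * \<bar>t\<bar>"
      by (intro mult_right_mono) (auto simp: dist_norm)
    also have "\<dots> = norm (t *\<^sub>R (b - (- 1 / t) *\<^sub>R y))" by simp
    also have "t *\<^sub>R (b - (- 1 / t) *\<^sub>R y) = t *\<^sub>R b + y"
      using False by (simp add: scaleR_diff_right scaleR_add_right)
    finally show ?thesis .
  qed simp
qed

text \<open>Heine-Borel for an arbitrary norm, by adding one spanning vector at a time: the part of
  the larger span inside a ball lies in a continuous image of an interval times a compact piece of
  the smaller span.\<close>

lemma compact_span_Int_cball:
  fixes B :: "'a::real_normed_vector set"
  assumes "finite B"
  shows "compact (span B \<inter> cball 0 r)"
  using assms
proof (induction B arbitrary: r)
  case empty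
  have "finite (span {} \<inter> cball (0::'a) r)" by auto
  then show ?case by (rule finite_imp_compact)
next
  case (insert b B)
  have cl: "closed (span B)" using insert.IH by (rule closed_if_compact_Int_cball)
  show ?case
  proof (cases "b \<in> span B")
    case True
    then show ?thesis using insert.IH span_redundant by metis
  next
    case False
    obtain d where d: "d > 0" "\<And>t y. y \<in> span B \<Longrightarrow> d * \<bar>t\<bar> \<le> norm (t *\<^sub>R b + y)"
      using scaleR_le_norm_add[OF subspace_span cl False] by metis
    \<comment> \<open>The bound \<open>r / d\<close> on the coefficient of \<open>b\<close> leaves a
      remainder \<open>x - t *\<^sub>R b\<close> of norm at most
      \<open>r + r / d * norm b\<close>.\<close>
    define C where "C = (\<lambda>(t, y). t *\<^sub>R b + y) ` ({- r / d..r / d} \<times> (span B \<inter> cball 0 (r + r / d * norm b)))"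
    have "compact C" unfolding C_def
      by (intro compact_continuous_image compact_Times insert.IH)
        (auto simp: case_prod_unfold intro!: continuous_intros)
    then have "compact (C \<inter> cball 0 r)" by (intro compact_Int_closed) auto
    moreover have "C \<subseteq> span (insert b B)"
      unfolding C_def using span_mono[of B "insert b B"]
      by (auto intro!: span_add span_scale span_base[of b])
    moreover have "x \<in> C" if x: "x \<in> span (insert b B)" "norm x \<le> r" for x
    proof -
      obtain t where t: "x - t *\<^sub>R b \<in> span B" using x(1) by (auto simp: span_insert)
      have "d * \<bar>t\<bar> \<le> r" using d(2)[OF t, of t] x(2) by simp
      then have t': "\<bar>t\<bar> \<le> r / d" using d(1) by (simp add: field_simps)
      have "norm (x - t *\<^sub>R b) \<le> norm x + \<bar>t\<bar> * norm b"
        using norm_triangle_ineq4[of x "t *\<^sub>R b"] by simp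
      also have "\<dots> \<le> r + r / d * norm b"
        using x(2) t' by (intro add_mono mult_right_mono) auto
      finally show ?thesis
        unfolding C_def using t t' by (intro image_eqI[of _ _ "(t, x - t *\<^sub>R b)"]) auto
    qed
    ultimately have "span (insert b B) \<inter> cball 0 r = C \<inter> cball 0 r" by auto
    then show ?thesis using \<open>compact (C \<inter> cball 0 r)\<close> by simp
  qed
qed

lemma finite_dimensional_basis:
  fixes S :: "'a::real_vector set"
  assumes "finite_dimensional TYPE('a)" "subspace S"
  obtains B where "finite B" "independent B" "span B = S" "card B = dim S"
proof -
  obtain C :: "'a set" where C: "finite C" "span C = UNIV"
    using assms(1) by (auto simp: finite_dimensional_def)
  obtain B where B: "B \<subseteq> S" "independent B" "S \<subseteq> span B" "card B = dim S"
    using basis_exists by blast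
  have "finite B" using independent_span_bound[OF C(1) B(2)] C by simp
  moreover have "span B = S" using B assms(2) span_subspace by blast
  ultimately show ?thesis using that B by blast
qed

lemma compact_subspace_Int_cball:
  fixes S :: "'a::real_normed_vector set"
  assumes "finite_dimensional TYPE('a)" "subspace S"
  shows "compact (S \<inter> cball 0 r)"
  using finite_dimensional_basis[OF assms] compact_span_Int_cball by metis

text \<open>The same induction: in \<open>f x = t *\<^sub>R f b + f (x - t *\<^sub>R b)\<close> both
  the coefficient and the remainder are controlled by \<open>norm x\<close>.\<close>

lemma linear_bounded_on_span:
  fixes f :: "'a::real_normed_vector \<Rightarrow> 'b::real_normed_vector"
  assumes "linear f" "finite B"
  shows "\<exists>K\<ge>0. \<forall>x\<in>span B. norm (f x) \<le> K * norm x"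
  using assms(2)
proof (induction B)
  case empty
  then show ?case using linear_0[OF assms(1)] by (auto intro: exI[of _ 0])
next
  case (insert b B)
  then obtain K where K: "K \<ge> 0" "\<And>x. x \<in> span B \<Longrightarrow> norm (f x) \<le> K * norm x" by auto
  show ?case
  proof (cases "b \<in> span B")
    case True
    then show ?thesis using K span_redundant by metis
  next
    case False
    have cl: "closed (span B)"
      using insert.hyps compact_span_Int_cball closed_if_compact_Int_cball by metis
    obtain d where d: "d > 0" "\<And>t y. y \<in> span B \<Longrightarrow> d * \<bar>t\<bar> \<le> norm (t *\<^sub>R b + y)"
      using scaleR_le_norm_add[OF subspace_span cl False] by metis
    let ?K = "(norm (f b) + K * norm b) / d + K"
    have "norm (f x) \<le> ?K * norm x" if x: "x \<in> span (insert b B)" for x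
    proof -
      obtain t where t: "x - t *\<^sub>R b \<in> span B" using x(1) by (auto simp: span_insert)
      have t': "\<bar>t\<bar> \<le> norm x / d" using d(2)[OF t, of t] d(1) by (simp add: field_simps)
      have "f x = t *\<^sub>R f b + f (x - t *\<^sub>R b)"
        using assms(1) by (simp add: linear_diff linear_scale)
      then have "norm (f x) \<le> \<bar>t\<bar> * norm (f b) + norm (f (x - t *\<^sub>R b))"
        using norm_triangle_ineq[of "t *\<^sub>R f b"] by (metis norm_scaleR)
      also have "\<dots> \<le> \<bar>t\<bar> * norm (f b) + K * norm (x - t *\<^sub>R b)" using K(2)[OF t] by simp
      also have "\<dots> \<le> \<bar>t\<bar> * norm (f b) + K * (norm x + \<bar>t\<bar> * norm b)"
        using norm_triangle_ineq4[of x "t *\<^sub>R b"] K(1) by (intro add_left_mono mult_left_mono) auto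
      also have "\<dots> = \<bar>t\<bar> * (norm (f b) + K * norm b) + K * norm x" by (simp add: algebra_simps)
      also have "\<dots> \<le> norm x / d * (norm (f b) + K * norm b) + K * norm x"
        using t' K(1) by (intro add_right_mono mult_right_mono) auto
      finally show ?thesis by (simp add: algebra_simps add_divide_distrib)
    qed
    moreover have "?K \<ge> 0" using K(1) d(1) by simp
    ultimately show ?thesis by blast
  qed
qed

section \<open>Automatic continuity of linear and bilinear maps\<close>

lemma linear_imp_bounded_linear:
  fixes f :: "'a::real_normed_vector \<Rightarrow> 'b::real_normed_vector"
  assumes "finite_dimensional TYPE('a)" "linear f"
  shows "bounded_linear f"
proof -
  obtain B :: "'a set" where "finite B" "span B = UNIV"
    using assms(1) by (auto simp: finite_dimensional_def)
  then obtain K where "\<And>x. norm (f x) \<le> K * norm x"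
    using linear_bounded_on_span[OF assms(2)] by (metis UNIV_I)
  then show ?thesis
    using assms(2) by (intro bounded_linear_intro[of _ K]) (auto simp: linear_add linear_scale mult.commute)
qed

lemma Blinfun_apply_linear:
  fixes f :: "'a::real_normed_vector \<Rightarrow> 'b::real_normed_vector"
  assumes "finite_dimensional TYPE('a)" "linear f"
  shows "blinfun_apply (Blinfun f) x = f x"
  using linear_imp_bounded_linear[OF assms] by (simp add: bounded_linear_Blinfun_apply)

lemma linear_Blinfun:
  fixes f :: "'c::real_vector \<Rightarrow> 'a::real_normed_vector \<Rightarrow> 'b::real_normed_vector"
  assumes "finite_dimensional TYPE('a)" "\<And>x. linear (f x)" "\<And>y. linear (\<lambda>x. f x y)"
  shows "linear (\<lambda>x. Blinfun (f x))"
  by (intro linearI blinfun_eqI)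
    (simp_all add: Blinfun_apply_linear[OF assms(1,2)] plus_blinfun.rep_eq scaleR_blinfun.rep_eq
      linear_add[OF assms(3)] linear_scale[OF assms(3)])

text \<open>By currying, a bilinear map becomes a linear, hence bounded, map into an operator space,
  followed by evaluation.\<close>

lemma bilinear_imp_bounded_bilinear:
  fixes f :: "'c::real_normed_vector \<Rightarrow> 'a::real_normed_vector \<Rightarrow> 'b::real_normed_vector"
  assumes "finite_dimensional TYPE('a)" "finite_dimensional TYPE('c)"
    and "\<And>x. linear (f x)" "\<And>y. linear (\<lambda>x. f x y)"
  shows "bounded_bilinear f"
proof -
  have "bounded_linear (\<lambda>x. Blinfun (f x))"
    using assms by (intro linear_imp_bounded_linear linear_Blinfun)
  then have "bounded_bilinear (\<lambda>x y. blinfun_apply (Blinfun (f x)) y)"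
    by (rule bounded_bilinear.comp1[OF bounded_bilinear_blinfun_apply])
  then show ?thesis by (simp add: Blinfun_apply_linear[OF assms(1,3)])
qed

text \<open>The rank-one maps \<open>E b w\<close>, a basis coordinate times a vector of a spanning
  set of the target, span the operator space. Iterating this covers the trilinear maps, among which
  the contraction and compactness arguments take place.\<close>

lemma finite_dimensional_blinfun:
  assumes "finite_dimensional TYPE('a::real_normed_vector)" "finite_dimensional TYPE('b::real_normed_vector)"
  shows "finite_dimensional TYPE('a \<Rightarrow>\<^sub>L 'b)"
proof -
  obtain B :: "'a set" where B: "finite B" "independent B" "span B = UNIV"
    using finite_dimensional_basis[OF assms(1) subspace_UNIV] by metis
  obtain C :: "'b set" where C: "finite C" "span C = UNIV"
    using assms(2) by (auto simp: finite_dimensional_def)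
  define E where "E b w = Blinfun (\<lambda>x. representation B x b *\<^sub>R w)" for b and w :: 'b
  have lin: "linear (\<lambda>x. representation B x b *\<^sub>R w)" for b and w :: 'b
    by (rule linearI) (simp_all add: representation_add representation_scale B scaleR_add_left)
  have E: "blinfun_apply (E b w) x = representation B x b *\<^sub>R w" for b w x
    unfolding E_def by (rule Blinfun_apply_linear[OF assms(1) lin])
  have linE: "linear (E b)" for b
    by (intro linearI blinfun_eqI) (simp_all add: E blinfun.add_left blinfun.scaleR_left scaleR_add_right)
  have "f \<in> span (\<Union>b\<in>B. E b ` C)" for f :: "'a \<Rightarrow>\<^sub>L 'b"
  proof -
    have "f = (\<Sum>b\<in>B. E b (blinfun_apply f b))"
    proof (rule blinfun_eqI)
      fix x
      have "blinfun_apply f x = blinfun_apply f (\<Sum>b\<in>B. representation B x b *\<^sub>R b)"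
        using sum_representation_eq[OF B(2) _ B(1) order_refl, of x] B(3) by simp
      then show "blinfun_apply f x = blinfun_apply (\<Sum>b\<in>B. E b (blinfun_apply f b)) x"
        by (simp add: blinfun.sum_right blinfun.scaleR_right blinfun.sum_left E)
    qed
    moreover have "E b (blinfun_apply f b) \<in> span (\<Union>b\<in>B. E b ` C)" if "b \<in> B" for b
    proof -
      have "E b (blinfun_apply f b) \<in> span (E b ` C)"
        using linear_span_image[OF linE, of b C] C(2) by auto
      then show ?thesis using that span_mono[of "E b ` C" "\<Union>b\<in>B. E b ` C"] by blast
    qed
    ultimately show ?thesis by (metis (no_types, lifting) span_sum)
  qed
  moreover have "finite (\<Union>b\<in>B. E b ` C)" using B C by simp
  ultimately show ?thesis unfolding finite_dimensional_def by blast
qed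


section \<open>Families of maps with a strict derivative\<close>

text \<open>
  The estimate is uniform in the parameter \<open>\<tau>\<close> near \<open>p\<close>, and the limit of \<open>f\<close> at \<open>(0, p)\<close> has to be \<open>p\<close>
  itself, so that maps \<open>\<tau> \<mapsto> \<tau> + D \<phi> \<tau>\<close> can be composed.
\<close>

definition strictly_differentiable ::
  "('a::real_normed_vector \<Rightarrow> 'e::real_normed_vector \<Rightarrow> 'e) \<Rightarrow> ('a \<Rightarrow> 'e) \<Rightarrow> 'e \<Rightarrow> bool" where
  "strictly_differentiable f L p \<longleftrightarrow> bounded_linear L \<and>
     (\<forall>e>0. \<exists>d>0. \<forall>\<phi> \<psi> \<tau>. norm \<phi> < d \<longrightarrow> norm \<psi> < d \<longrightarrow> dist \<tau> p < d \<longrightarrow>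
        norm (f \<phi> \<tau> - f \<psi> \<tau> - L (\<phi> - \<psi>)) \<le> e * norm (\<phi> - \<psi>) \<and> dist (f \<phi> \<tau>) p < e)"

lemma strictly_differentiableD:
  assumes "strictly_differentiable f L p" "e > 0"
  obtains d where "d > 0"
    "\<And>\<phi> \<psi> \<tau>. norm \<phi> < d \<Longrightarrow> norm \<psi> < d \<Longrightarrow> dist \<tau> p < d \<Longrightarrow>
        norm (f \<phi> \<tau> - f \<psi> \<tau> - L (\<phi> - \<psi>)) \<le> e * norm (\<phi> - \<psi>)"
    "\<And>\<phi> \<tau>. norm \<phi> < d \<Longrightarrow> dist \<tau> p < d \<Longrightarrow> dist (f \<phi> \<tau>) p < e"
proof -
  obtain d where d: "d > 0" "\<forall>\<phi> \<psi> \<tau>. norm \<phi> < d \<longrightarrow> norm \<psi> < d \<longrightarrow> dist \<tau> p < d \<longrightarrow>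
        norm (f \<phi> \<tau> - f \<psi> \<tau> - L (\<phi> - \<psi>)) \<le> e * norm (\<phi> - \<psi>) \<and> dist (f \<phi> \<tau>) p < e"
    using assms unfolding strictly_differentiable_def by blast
  show ?thesis
  proof (rule that[OF d(1)])
    show "norm (f \<phi> \<tau> - f \<psi> \<tau> - L (\<phi> - \<psi>)) \<le> e * norm (\<phi> - \<psi>)"
      if "norm \<phi> < d" "norm \<psi> < d" "dist \<tau> p < d" for \<phi> \<psi> \<tau>
      using d(2) that by blast
    show "dist (f \<phi> \<tau>) p < e" if "norm \<phi> < d" "dist \<tau> p < d" for \<phi> \<tau>
      using d(2) that by blast
  qed
qed

lemma strictly_differentiable_id: "strictly_differentiable (\<lambda>\<phi> \<tau>. \<tau>) (\<lambda>_. 0) p"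
  unfolding strictly_differentiable_def by auto

text \<open>A product rule. It allows a nonlinear action to be built as a composite of simple steps
  while its derivative is collected along the way.\<close>

lemma strictly_differentiable_add_bilinear:
  fixes f :: "'a::real_normed_vector \<Rightarrow> 'e::real_normed_vector \<Rightarrow> 'e"
  assumes D: "bounded_bilinear D" and f: "strictly_differentiable f L p"
  shows "strictly_differentiable (\<lambda>\<phi> \<tau>. f \<phi> \<tau> + D \<phi> (f \<phi> \<tau>)) (\<lambda>\<phi>. L \<phi> + D \<phi> p) p"
  unfolding strictly_differentiable_def
proof (intro conjI allI impI)
  interpret D: bounded_bilinear D by fact
  have L: "bounded_linear L" using f by (simp add: strictly_differentiable_def)
  then interpret L: bounded_linear L .
  show "bounded_linear (\<lambda>\<phi>. L \<phi> + D \<phi> p)"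
    by (intro bounded_linear_add L D.bounded_linear_left)
  obtain C where C: "C > 0" "\<And>a b. norm (D a b) \<le> norm a * norm b * C" using D.pos_bounded by blast
  obtain M where M: "M > 0" "\<And>a. norm (L a) \<le> norm a * M" using L.pos_bounded by blast
  fix e :: real assume e: "e > 0"
  define e1 where "e1 = min (min 1 (e / 3)) (e / (3 * C))"
  have e1: "e1 > 0" "e1 \<le> 1" "e1 \<le> e / 3" "C * e1 \<le> e / 3"
    using e C by (auto simp: e1_def min_def field_simps)
  obtain d1 where d1: "d1 > 0"
    "\<And>\<phi> \<psi> \<tau>. norm \<phi> < d1 \<Longrightarrow> norm \<psi> < d1 \<Longrightarrow> dist \<tau> p < d1 \<Longrightarrow>
        norm (f \<phi> \<tau> - f \<psi> \<tau> - L (\<phi> - \<psi>)) \<le> e1 * norm (\<phi> - \<psi>)"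
    "\<And>\<phi> \<tau>. norm \<phi> < d1 \<Longrightarrow> dist \<tau> p < d1 \<Longrightarrow> dist (f \<phi> \<tau>) p < e1"
    by (rule strictly_differentiableD[OF f e1(1)]) (rule that; assumption)
  \<comment> \<open>The factor \<open>M + 1 + norm p\<close> dominates both the Lipschitz constant
    \<open>M + 1\<close> of \<open>f\<close> in \<phi> and the bound \<open>1 + norm p\<close> on
    its values.\<close>
  define d where "d = min d1 (e / (3 * C * (M + 1 + norm p)))"
  have pos: "3 * C * (M + 1 + norm p) > 0" using C M by (simp add: add_pos_nonneg)
  have d: "d > 0" "d \<le> d1" unfolding d_def using d1(1) e pos by auto
  have "d \<le> e / (3 * C * (M + 1 + norm p))" unfolding d_def by simp
  then have "d * (3 * C * (M + 1 + norm p)) \<le> e" by (simp only: pos_le_divide_eq[OF pos])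
  then have d': "C * d * (M + 1 + norm p) \<le> e / 3" by (simp add: algebra_simps)
  show "\<exists>d>0. \<forall>\<phi> \<psi> \<tau>. norm \<phi> < d \<longrightarrow> norm \<psi> < d \<longrightarrow> dist \<tau> p < d \<longrightarrow>
        norm (f \<phi> \<tau> + D \<phi> (f \<phi> \<tau>) - (f \<psi> \<tau> + D \<psi> (f \<psi> \<tau>)) - (L (\<phi> - \<psi>) + D (\<phi> - \<psi>) p))
          \<le> e * norm (\<phi> - \<psi>) \<and> dist (f \<phi> \<tau> + D \<phi> (f \<phi> \<tau>)) p < e"
  proof (intro exI[of _ d] conjI allI impI d(1))
    fix \<phi> \<psi> :: 'a and \<tau> :: 'e assume small: "norm \<phi> < d" "norm \<psi> < d" "dist \<tau> p < d"
    let ?n = "norm (\<phi> - \<psi>)"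
    have f1: "norm (f \<phi> \<tau> - f \<psi> \<tau> - L (\<phi> - \<psi>)) \<le> e1 * ?n" using d1(2) small d by force
    have f2: "norm (f \<phi> \<tau> - p) \<le> e1" using d1(3)[of \<phi> \<tau>] small d by (force simp: dist_norm)
    have "norm (f \<phi> \<tau> - f \<psi> \<tau>) \<le> e1 * ?n + ?n * M"
      using norm_triangle_ineq[of "f \<phi> \<tau> - f \<psi> \<tau> - L (\<phi> - \<psi>)" "L (\<phi> - \<psi>)"] f1 M(2)[of "\<phi> - \<psi>"]
      by simp
    also have "\<dots> \<le> 1 * ?n + ?n * M" using e1 by (intro add_right_mono mult_right_mono) auto
    finally have f3: "norm (f \<phi> \<tau> - f \<psi> \<tau>) \<le> ?n * (M + 1)" by (simp add: algebra_simps)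
    have "norm (D (\<phi> - \<psi>) (f \<phi> \<tau> - p)) \<le> ?n * norm (f \<phi> \<tau> - p) * C" by (rule C(2))
    also have "\<dots> \<le> ?n * e1 * C"
      using f2 C(1) by (intro mult_right_mono mult_left_mono) auto
    also have "\<dots> \<le> ?n * (e / 3)" using mult_left_mono[OF e1(4), of ?n] by (simp add: algebra_simps)
    finally have g1: "norm (D (\<phi> - \<psi>) (f \<phi> \<tau> - p)) \<le> ?n * (e / 3)" .
    have "norm (D \<psi> (f \<phi> \<tau> - f \<psi> \<tau>)) \<le> norm \<psi> * norm (f \<phi> \<tau> - f \<psi> \<tau>) * C" by (rule C(2))
    also have "\<dots> \<le> d * (?n * (M + 1)) * C"
      using f3 small C(1) d(1) by (intro mult_right_mono mult_mono) auto
    also have "\<dots> \<le> ?n * (C * d * (M + 1 + norm p))"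
      using C(1) d(1) M(1) by (simp add: algebra_simps)
    also have "\<dots> \<le> ?n * (e / 3)" using d' by (intro mult_left_mono) auto
    finally have g2: "norm (D \<psi> (f \<phi> \<tau> - f \<psi> \<tau>)) \<le> ?n * (e / 3)" .
    have g3: "e1 * ?n \<le> ?n * (e / 3)" using mult_right_mono[OF e1(3), of ?n] by (simp add: algebra_simps)
    \<comment> \<open>The three summands are small for different reasons: strict differentiability
      of \<open>f\<close>, closeness of the values of \<open>f\<close> to \<open>p\<close>, and
      smallness of \<psi>.\<close>
    have "f \<phi> \<tau> + D \<phi> (f \<phi> \<tau>) - (f \<psi> \<tau> + D \<psi> (f \<psi> \<tau>)) - (L (\<phi> - \<psi>) + D (\<phi> - \<psi>) p)
        = (f \<phi> \<tau> - f \<psi> \<tau> - L (\<phi> - \<psi>)) + D (\<phi> - \<psi>) (f \<phi> \<tau> - p) + D \<psi> (f \<phi> \<tau> - f \<psi> \<tau>)"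
      by (simp add: D.diff_left D.diff_right algebra_simps)
    also have "norm \<dots> \<le> norm (f \<phi> \<tau> - f \<psi> \<tau> - L (\<phi> - \<psi>)) + norm (D (\<phi> - \<psi>) (f \<phi> \<tau> - p))
        + norm (D \<psi> (f \<phi> \<tau> - f \<psi> \<tau>))"
      by (intro norm_triangle_le add_mono order_refl norm_triangle_ineq)
    also have "\<dots> \<le> e * ?n" using f1 g1 g2 g3 by (simp add: algebra_simps)
    finally show "norm (f \<phi> \<tau> + D \<phi> (f \<phi> \<tau>) - (f \<psi> \<tau> + D \<psi> (f \<psi> \<tau>)) - (L (\<phi> - \<psi>) + D (\<phi> - \<psi>) p))
          \<le> e * ?n" .
    have "norm (f \<phi> \<tau>) \<le> 1 + norm p"
      using norm_triangle_ineq[of "f \<phi> \<tau> - p" p] f2 e1(2) by simp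
    then have "norm (f \<phi> \<tau>) \<le> M + 1 + norm p" using M(1) by simp
    then have "norm \<phi> * norm (f \<phi> \<tau>) * C \<le> d * (M + 1 + norm p) * C"
      using small C(1) d(1) by (intro mult_right_mono mult_mono) auto
    also have "\<dots> \<le> e / 3" using d' by (simp add: algebra_simps)
    finally have g4: "norm (D \<phi> (f \<phi> \<tau>)) \<le> e / 3" using C(2)[of \<phi> "f \<phi> \<tau>"] by linarith
    have "dist (f \<phi> \<tau> + D \<phi> (f \<phi> \<tau>)) p = norm ((f \<phi> \<tau> - p) + D \<phi> (f \<phi> \<tau>))"
      by (simp add: dist_norm algebra_simps)
    also have "\<dots> \<le> norm (f \<phi> \<tau> - p) + norm (D \<phi> (f \<phi> \<tau>))" by (rule norm_triangle_ineq)
    also have "\<dots> \<le> e / 3 + e / 3" using f2 e1 g4 by linarith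
    also have "\<dots> < e" using e by simp
    finally show "dist (f \<phi> \<tau> + D \<phi> (f \<phi> \<tau>)) p < e" .
  qed
qed

section \<open>Two perturbation results\<close>

text \<open>A simplified Newton iteration with parameter \<tau>: zeros of
  \<open>J (\<mu> (a k) \<tau>)\<close> are fixed points of
  \<open>k - J (\<mu> (a k) \<tau>)\<close>. Since \<open>J\<close>, \<open>L\<close> and
  \<open>a\<close> compose to the identity on \<open>K\<close>, the linear part of this map cancels,
  and only the linearisation error remains.\<close>

lemma solve_by_contraction:
  fixes \<mu> :: "'a::real_normed_vector \<Rightarrow> 'e::real_normed_vector \<Rightarrow> 'e" and K :: "'e set"
  assumes fd: "finite_dimensional TYPE('e)" and K: "subspace K"
    and \<mu>: "strictly_differentiable \<mu> L p" "\<And>\<tau>. \<mu> 0 \<tau> = \<tau>"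
    and J: "bounded_linear J" "range J \<subseteq> K" "J p = 0"
    and a: "bounded_linear a" and inv: "\<And>k. k \<in> K \<Longrightarrow> J (L (a k)) = k"
    and r: "r > 0"
  obtains d where "d > 0" "\<And>\<tau>. dist \<tau> p < d \<Longrightarrow> \<exists>k\<in>K. norm k \<le> r \<and> J (\<mu> (a k) \<tau>) = 0"
proof -
  interpret J: bounded_linear J by fact
  interpret a: bounded_linear a by fact
  obtain C where C: "C > 0" "\<And>x. norm (J x) \<le> norm x * C" using J.pos_bounded by blast
  obtain A where A: "A > 0" "\<And>x. norm (a x) \<le> norm x * A" using a.pos_bounded by blast
  \<comment> \<open>With \<open>C\<close> and \<open>A\<close> bounding \<open>J\<close> and
    \<open>a\<close>, this tolerance yields the contraction factor 1/2.\<close>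
  have pos: "1 / (2 * C * A) > 0" using A C by simp
  obtain d0 where d0: "d0 > 0"
    "\<And>\<phi> \<psi> \<tau>. norm \<phi> < d0 \<Longrightarrow> norm \<psi> < d0 \<Longrightarrow> dist \<tau> p < d0 \<Longrightarrow>
        norm (\<mu> \<phi> \<tau> - \<mu> \<psi> \<tau> - L (\<phi> - \<psi>)) \<le> 1 / (2 * C * A) * norm (\<phi> - \<psi>)"
    by (rule strictly_differentiableD[OF \<mu>(1) pos]) (rule that; assumption)
  \<comment> \<open>The radius \<open>s\<close> keeps \<open>a k\<close> where the derivative
    estimate holds; \<open>d\<close> below limits the displacement of 0 to \<open>s / 2\<close>, so
    the ball of radius \<open>s\<close> is mapped to itself.\<close>
  define s where "s = min r (d0 / (2 * A))"
  have s: "s > 0" "s \<le> r" "s * A < d0" using r d0 A by (auto simp: s_def min_def field_simps)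
  define d where "d = min d0 (s / (2 * C))"
  have d: "d > 0" "d \<le> d0" "d * C \<le> s / 2" using d0 s C by (auto simp: d_def min_def field_simps)
  have "\<exists>k\<in>K. norm k \<le> r \<and> J (\<mu> (a k) \<tau>) = 0" if \<tau>: "dist \<tau> p < d" for \<tau>
  proof -
    define S where "S = K \<inter> cball 0 s"
    define \<Psi> where "\<Psi> k = k - J (\<mu> (a k) \<tau>)" for k
    have S0: "0 \<in> S" using subspace_0[OF K] s by (simp add: S_def)
    have lip: "dist (\<Psi> k) (\<Psi> l) \<le> 1 / 2 * dist k l" if "k \<in> S" "l \<in> S" for k l
    proof -
      have kl: "k - l \<in> K" using that K subspace_diff by (auto simp: S_def)
      have small: "norm (a x) < d0" if "x \<in> S" for x
      proof -
        have "norm (a x) \<le> s * A"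
          using order_trans[OF A(2)[of x] mult_right_mono[of "norm x" s A]] A(1) that by (simp add: S_def)
        then show ?thesis using s by simp
      qed
      \<comment> \<open>Writing \<open>k - l\<close> as \<open>J (L (a (k - l)))\<close> turns the
        difference into \<open>J\<close> applied to the linearisation error.\<close>
      have "\<Psi> k - \<Psi> l = J (L (a (k - l))) - J (\<mu> (a k) \<tau> - \<mu> (a l) \<tau>)"
        by (simp add: \<Psi>_def inv[OF kl] J.diff)
      also have "\<dots> = - J (\<mu> (a k) \<tau> - \<mu> (a l) \<tau> - L (a k - a l))"
        by (simp add: J.diff a.diff)
      finally have "norm (\<Psi> k - \<Psi> l) \<le> norm (\<mu> (a k) \<tau> - \<mu> (a l) \<tau> - L (a k - a l)) * C"
        using C(2) by simp
      also have "\<dots> \<le> 1 / (2 * C * A) * norm (a k - a l) * C"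
        using C(1) \<tau> d(2) that by (intro mult_right_mono d0(2) small) auto
      also have "\<dots> = 1 / (2 * A) * norm (a (k - l))" using C(1) by (simp add: a.diff)
      also have "\<dots> \<le> 1 / (2 * A) * (norm (k - l) * A)"
        using A(1) by (intro mult_left_mono A(2)) auto
      also have "\<dots> = 1 / 2 * norm (k - l)" using A(1) by simp
      finally show ?thesis by (simp add: dist_norm)
    qed
    have "\<Psi> ` S \<subseteq> S"
    proof
      fix y assume "y \<in> \<Psi> ` S"
      then obtain k where k: "k \<in> S" "y = \<Psi> k" by blast
      have "norm (\<Psi> 0) = norm (J (\<tau> - p))" by (simp add: \<Psi>_def a.zero \<mu>(2) J.diff J(3))
      also have "\<dots> \<le> d * C"
        using order_trans[OF C(2)[of "\<tau> - p"] mult_right_mono[of "norm (\<tau> - p)" d C]] \<tau> C(1) by (simp add: dist_norm)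
      finally have "norm (\<Psi> 0) \<le> s / 2" using d(3) by simp
      moreover have "dist (\<Psi> k) (\<Psi> 0) \<le> s / 2"
        using lip[OF k(1) S0] k(1) by (simp add: S_def)
      ultimately have "norm (\<Psi> k) \<le> s"
        using norm_triangle_ineq[of "\<Psi> k - \<Psi> 0" "\<Psi> 0"] by (simp add: dist_norm)
      moreover have "\<Psi> k \<in> K"
        unfolding \<Psi>_def using k(1) J(2) by (intro subspace_diff[OF K]) (auto simp: S_def)
      ultimately show "y \<in> S" using k(2) by (simp add: S_def)
    qed
    moreover have "complete S"
      unfolding S_def using compact_subspace_Int_cball[OF fd K] compact_imp_complete by blast
    ultimately obtain k where "k \<in> S" "\<Psi> k = k"
      using Banach_fix[of S "1 / 2" \<Psi>] lip S0 by auto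
    then show ?thesis using s(2) by (intro bexI[of _ k]) (auto simp: S_def \<Psi>_def)
  qed
  with d(1) show ?thesis using that by blast
qed

text \<open>Otherwise there are parameters tending to \<open>p\<close> with nonzero common zeros in
  \<open>M\<close>. By homogeneity these can be normalised, and by compactness of the unit sphere of
  \<open>M\<close> a subsequence converges to a unit vector annihilated at \<open>p\<close>. The
  index set \<open>T\<close> may be infinite, so a whole system of equations is treated at
  once.\<close>

lemma injective_family_nearby:
  fixes G :: "'i \<Rightarrow> 'p::metric_space \<Rightarrow> 'e::real_normed_vector \<Rightarrow> 'd::real_normed_vector"
  assumes fd: "finite_dimensional TYPE('e)" and M: "subspace M"
    and cont: "\<And>t s m m0. t \<in> T \<Longrightarrow> s \<longlonglongrightarrow> p \<Longrightarrow> m \<longlonglongrightarrow> m0 \<Longrightarrow> (\<lambda>n::nat. G t (s n) (m n)) \<longlonglongrightarrow> G t p m0"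
    and hom: "\<And>t s c m. G t s (c *\<^sub>R m) = c *\<^sub>R G t s m"
    and inj: "\<And>m. m \<in> M \<Longrightarrow> (\<And>t. t \<in> T \<Longrightarrow> G t p m = 0) \<Longrightarrow> m = 0"
  obtains d where "d > 0"
    "\<And>s m. dist s p < d \<Longrightarrow> m \<in> M \<Longrightarrow> (\<And>t. t \<in> T \<Longrightarrow> G t s m = 0) \<Longrightarrow> m = 0"
proof (rule ccontr)
  assume neg: "\<not> thesis"
  have "\<forall>n. \<exists>q. dist (fst q) p < inverse (real (Suc n)) \<and> snd q \<in> M \<and> snd q \<noteq> 0 \<and> (\<forall>t\<in>T. G t (fst q) (snd q) = 0)"
  proof (rule ccontr)
    assume "\<not> ?thesis"
    then obtain n where n: "\<not> (\<exists>q. dist (fst q) p < inverse (real (Suc n)) \<and> snd q \<in> M \<and> snd q \<noteq> 0 \<and>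
        (\<forall>t\<in>T. G t (fst q) (snd q) = 0))"
      unfolding not_all by (rule exE)
    have thesis
    proof (rule that)
      show "inverse (real (Suc n)) > 0" by simp
      show "m = 0" if "dist s p < inverse (real (Suc n))" "m \<in> M" "\<And>t. t \<in> T \<Longrightarrow> G t s m = 0" for s m
      proof (rule ccontr)
        assume "m \<noteq> 0"
        with that n show False by (auto simp del: of_nat_Suc dest!: spec[of _ "(s, m)"])
      qed
    qed
    with neg show False by blast
  qed
  from choice[OF this] obtain q where
    q: "\<forall>n. dist (fst (q n)) p < inverse (real (Suc n)) \<and> snd (q n) \<in> M \<and> snd (q n) \<noteq> 0 \<and>
      (\<forall>t\<in>T. G t (fst (q n)) (snd (q n)) = 0)" by (rule exE)
  define s where "s n = fst (q n)" for n
  define m where "m n = snd (q n)" for n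
  have sm: "dist (s n) p < inverse (real (Suc n))" "m n \<in> M"
    "m n \<noteq> 0" "t \<in> T \<Longrightarrow> G t (s n) (m n) = 0" for n t
    using q[rule_format, of n] by (simp_all add: s_def m_def)
  have s: "s \<longlonglongrightarrow> p"
  proof (rule tendsto_dist_iff[THEN iffD2, OF tendsto_sandwich[OF _ _ tendsto_const LIMSEQ_inverse_real_of_nat]])
    show "\<forall>\<^sub>F n in sequentially. 0 \<le> dist (s n) p" by simp
    show "\<forall>\<^sub>F n in sequentially. dist (s n) p \<le> inverse (real (Suc n))"
      using sm(1) by (intro always_eventually allI less_imp_le)
  qed
  define u where "u n = (1 / norm (m n)) *\<^sub>R m n" for n
  have "compact (M \<inter> cball 0 1 \<inter> sphere 0 1)"
    using compact_subspace_Int_cball[OF fd M]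
    by (rule compact_Int_closed) (auto simp: sphere_def dist_norm intro!: closed_Collect_eq continuous_intros)
  moreover have "u n \<in> M \<inter> cball 0 1 \<inter> sphere 0 1" for n
    using sm(2,3) subspace_scale[OF M] by (auto simp: u_def)
  ultimately obtain l r where "l \<in> M \<inter> cball 0 1 \<inter> sphere 0 1" and lr: "strict_mono r" "(u \<circ> r) \<longlonglongrightarrow> l"
    unfolding compact_def by blast
  then have l: "l \<in> M" "norm l = 1" by auto
  have "G t p l = 0" if t: "t \<in> T" for t
  proof (rule LIMSEQ_unique)
    show "(\<lambda>n. G t ((s \<circ> r) n) ((u \<circ> r) n)) \<longlonglongrightarrow> G t p l"
      using t LIMSEQ_subseq_LIMSEQ[OF s lr(1)] lr(2) by (rule cont)
    show "(\<lambda>n. G t ((s \<circ> r) n) ((u \<circ> r) n)) \<longlonglongrightarrow> 0"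
      using sm(4)[OF t] by (simp add: u_def hom)
  qed
  then have "l = 0" by (rule inj[OF l(1)])
  then show False using l(2) by simp
qed


section \<open>Pulling back a trilinear map\<close>

text \<open>Alternation is left out, because intermediate maps such as
  \<open>apply3 \<tau> (\<phi> x) y z\<close> are in general not alternating.\<close>

definition trilinear :: "('a::real_vector \<Rightarrow> 'a \<Rightarrow> 'a \<Rightarrow> 'a) \<Rightarrow> bool" where
  "trilinear f \<longleftrightarrow> (\<forall>y z. linear (\<lambda>x. f x y z)) \<and> (\<forall>x z. linear (\<lambda>y. f x y z)) \<and> (\<forall>x y. linear (\<lambda>z. f x y z))"

text \<open>Iterated operator spaces make trilinear maps into a normed space, which is
  finite-dimensional if \<open>'a\<close> is.\<close>

type_synonym 'a blinfun3 = "'a \<Rightarrow>\<^sub>L 'a \<Rightarrow>\<^sub>L 'a \<Rightarrow>\<^sub>L 'a"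

abbreviation apply3 :: "'a::real_normed_vector blinfun3 \<Rightarrow> 'a \<Rightarrow> 'a \<Rightarrow> 'a \<Rightarrow> 'a" where
  "apply3 \<tau> x y z \<equiv> blinfun_apply (blinfun_apply (blinfun_apply \<tau> x) y) z"

definition Blinfun3 :: "('a::real_normed_vector \<Rightarrow> 'a \<Rightarrow> 'a \<Rightarrow> 'a) \<Rightarrow> 'a blinfun3" where
  "Blinfun3 f = Blinfun (\<lambda>x. Blinfun (\<lambda>y. Blinfun (f x y)))"

lemma trilinear_apply3: "trilinear (apply3 \<tau>)"
  unfolding trilinear_def by (auto intro!: linearI simp: blinfun.bilinear_simps)

lemma blinfun3_eqI: "(\<And>x y z. apply3 \<tau> x y z = apply3 \<sigma> x y z) \<Longrightarrow> \<tau> = \<sigma>"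
  by (intro blinfun_eqI)

lemma apply3_Blinfun3:
  fixes f :: "'a::real_normed_vector \<Rightarrow> 'a \<Rightarrow> 'a \<Rightarrow> 'a"
  assumes fd: "finite_dimensional TYPE('a)" and f: "trilinear f"
  shows "apply3 (Blinfun3 f) x y z = f x y z"
proof -
  have l1: "linear (\<lambda>x. f x y z)" and l2: "linear (\<lambda>y. f x y z)" and l3: "linear (f x y)" for x y z
    using f by (auto simp: trilinear_def)
  have l4: "linear (\<lambda>y. Blinfun (f x y))" for x
    by (rule linear_Blinfun[OF fd l3 l2])
  have l5: "linear (\<lambda>x. Blinfun (f x y))" for y
    by (rule linear_Blinfun[OF fd l3 l1])
  have "linear (\<lambda>x. Blinfun (\<lambda>y. Blinfun (f x y)))"
    by (rule linear_Blinfun[OF fd l4 l5])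
  then show ?thesis
    unfolding Blinfun3_def by (simp add: Blinfun_apply_linear[OF fd] l4 l3)
qed

lemma norm_blinfun3_le:
  fixes \<tau> :: "'a::real_normed_vector blinfun3"
  assumes "d \<ge> 0" "\<And>x y z. norm (apply3 \<tau> x y z) \<le> d * norm x * norm y * norm z"
  shows "norm \<tau> \<le> d"
  using assms by (intro norm_blinfun_bound) (auto simp: mult.assoc)

lemma bounded_bilinear_Blinfun3:
  fixes f :: "'c::real_normed_vector \<Rightarrow> 'd::real_normed_vector \<Rightarrow> 'a::real_normed_vector \<Rightarrow> 'a \<Rightarrow> 'a \<Rightarrow> 'a"
  assumes fd: "finite_dimensional TYPE('c)" "finite_dimensional TYPE('d)" "finite_dimensional TYPE('a)"
    and "\<And>a b. trilinear (f a b)"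
    and "\<And>a x y z. linear (\<lambda>b. f a b x y z)" "\<And>b x y z. linear (\<lambda>a. f a b x y z)"
  shows "bounded_bilinear (\<lambda>a b. Blinfun3 (f a b))"
  by (intro bilinear_imp_bounded_bilinear fd linearI blinfun3_eqI)
    (simp_all add: blinfun.bilinear_simps apply3_Blinfun3[OF fd(3) assms(4)]
      linear_add[OF assms(5)] linear_scale[OF assms(5)] linear_add[OF assms(6)] linear_scale[OF assms(6)])

text \<open>This is the pullback along \<open>1 + \<phi>\<close> only if \<open>\<phi> \<circ> \<phi> = 0\<close>, as \<open>1 - \<phi>\<close> is the inverse of \<open>1 + \<phi>\<close> then.\<close>

definition conj_act :: "('a::real_normed_vector \<Rightarrow>\<^sub>L 'a) \<Rightarrow> 'a blinfun3 \<Rightarrow> 'a blinfun3" where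
  "conj_act \<phi> \<tau> = Blinfun3 (\<lambda>x y z. let w = apply3 \<tau> (x + \<phi> x) (y + \<phi> y) (z + \<phi> z) in w - \<phi> w)"

text \<open>The infinitesimal action of \<phi> on \<open>p\<close>. For alternating \<open>p\<close>
  the arguments can be rotated, and the expression becomes the coboundary of a 1-cochain as in
  \<open>coboundary_1\<close>.\<close>

definition conj_act_deriv :: "'a::real_normed_vector blinfun3 \<Rightarrow> ('a \<Rightarrow>\<^sub>L 'a) \<Rightarrow> 'a blinfun3" where
  "conj_act_deriv p \<phi> = Blinfun3 (\<lambda>x y z. apply3 p (\<phi> x) y z + apply3 p x (\<phi> y) z + apply3 p x y (\<phi> z)
     - \<phi> (apply3 p x y z))"

lemma apply3_conj_act:
  fixes \<phi> :: "'a::real_normed_vector \<Rightarrow>\<^sub>L 'a"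
  assumes fd: "finite_dimensional TYPE('a)"
  shows "apply3 (conj_act \<phi> \<tau>) x y z =
    apply3 \<tau> (x + \<phi> x) (y + \<phi> y) (z + \<phi> z) - \<phi> (apply3 \<tau> (x + \<phi> x) (y + \<phi> y) (z + \<phi> z))"
  unfolding conj_act_def
  by (subst apply3_Blinfun3[OF fd])
    (auto simp: trilinear_def Let_def blinfun.bilinear_simps algebra_simps intro!: linearI)

lemma apply3_conj_act_deriv:
  fixes \<phi> :: "'a::real_normed_vector \<Rightarrow>\<^sub>L 'a"
  assumes fd: "finite_dimensional TYPE('a)"
  shows "apply3 (conj_act_deriv p \<phi>) x y z = apply3 p (\<phi> x) y z + apply3 p x (\<phi> y) z + apply3 p x y (\<phi> z)
     - \<phi> (apply3 p x y z)"
  unfolding conj_act_deriv_def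
  by (subst apply3_Blinfun3[OF fd])
    (auto simp: trilinear_def blinfun.bilinear_simps algebra_simps intro!: linearI)

text \<open>The action is a composite of four maps of the form
  \<open>\<tau> + D \<phi> \<tau>\<close>: \<open>1 + \<phi>\<close> is inserted into the three
  arguments one after the other, then \<open>1 - \<phi>\<close> is applied to the value. The
  derivative is the sum of the four terms \<open>D \<phi> p\<close>.\<close>

lemma strictly_differentiable_conj_act:
  fixes p :: "'a::real_normed_vector blinfun3"
  assumes fd: "finite_dimensional TYPE('a)"
  shows "strictly_differentiable conj_act (conj_act_deriv p) p"
proof -
  define D1 D2 D3 D4 :: "('a \<Rightarrow>\<^sub>L 'a) \<Rightarrow> 'a blinfun3 \<Rightarrow> 'a blinfun3"
    where "D1 \<phi> \<tau> = Blinfun3 (\<lambda>x y z. apply3 \<tau> (\<phi> x) y z)"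
      and "D2 \<phi> \<tau> = Blinfun3 (\<lambda>x y z. apply3 \<tau> x (\<phi> y) z)"
      and "D3 \<phi> \<tau> = Blinfun3 (\<lambda>x y z. apply3 \<tau> x y (\<phi> z))"
      and "D4 \<phi> \<tau> = Blinfun3 (\<lambda>x y z. - \<phi> (apply3 \<tau> x y z))" for \<phi> \<tau>
  note D_defs = D1_def D2_def D3_def D4_def
  have fds: "finite_dimensional TYPE('a \<Rightarrow>\<^sub>L 'a)" "finite_dimensional TYPE('a blinfun3)"
    using fd by (auto intro!: finite_dimensional_blinfun)
  have tri: "trilinear (\<lambda>x y z. apply3 \<tau> (\<phi> x) y z)" "trilinear (\<lambda>x y z. apply3 \<tau> x (\<phi> y) z)"
    "trilinear (\<lambda>x y z. apply3 \<tau> x y (\<phi> z))" "trilinear (\<lambda>x y z. - \<phi> (apply3 \<tau> x y z))"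
    for \<phi> :: "'a \<Rightarrow>\<^sub>L 'a" and \<tau>
    by (auto simp: trilinear_def blinfun.bilinear_simps intro!: linearI)
  have bil: "bounded_bilinear D1" "bounded_bilinear D2" "bounded_bilinear D3" "bounded_bilinear D4"
    unfolding D_defs by (intro bounded_bilinear_Blinfun3 fd fds tri linearI; simp add: blinfun.bilinear_simps)+
  have ap: "apply3 (D1 \<phi> \<tau>) x y z = apply3 \<tau> (\<phi> x) y z" "apply3 (D2 \<phi> \<tau>) x y z = apply3 \<tau> x (\<phi> y) z"
    "apply3 (D3 \<phi> \<tau>) x y z = apply3 \<tau> x y (\<phi> z)" "apply3 (D4 \<phi> \<tau>) x y z = - \<phi> (apply3 \<tau> x y z)"
    for \<phi> \<tau> x y z
    unfolding D_defs by (simp_all add: apply3_Blinfun3[OF fd] tri)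
  note sd = strictly_differentiable_add_bilinear[OF bil(4) strictly_differentiable_add_bilinear[OF bil(3)
    strictly_differentiable_add_bilinear[OF bil(2) strictly_differentiable_add_bilinear[OF bil(1)
    strictly_differentiable_id[of p]]]]]
  show ?thesis
    by (rule sd[THEN arg_cong2[where f = "\<lambda>f L. strictly_differentiable f L p", THEN iffD1, rotated 2]];
      intro ext blinfun3_eqI; simp add: ap apply3_conj_act[OF fd] apply3_conj_act_deriv[OF fd] blinfun.bilinear_simps)
qed


section \<open>Cocycles and coboundaries\<close>

lemma elt_set_plus_eq_iff:
  fixes h :: "'a::real_vector set"
  assumes "subspace h"
  shows "x +o h = y +o h \<longleftrightarrow> x - y \<in> h"
proof
  assume "x +o h = y +o h"
  moreover have "x \<in> x +o h" using subspace_0[OF assms] set_plus_intro2[of 0 h x] by simp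
  ultimately show "x - y \<in> h" by (auto simp: elt_set_plus_def)
next
  have *: "x +o h \<subseteq> y +o h" if "x - y \<in> h" for x y
  proof
    fix w assume "w \<in> x +o h"
    then obtain c where c: "c \<in> h" "w = x + c" by (auto simp: elt_set_plus_def)
    then have "w = y + ((x - y) + c)" by simp
    moreover have "(x - y) + c \<in> h" using c that assms subspace_add by blast
    ultimately show "w \<in> y +o h" unfolding elt_set_plus_def by blast
  qed
  assume "x - y \<in> h"
  moreover from this have "y - x \<in> h" using subspace_neg[OF assms, of "x - y"] by simp
  ultimately show "x +o h = y +o h" using * by blast
qed

lemma elt_set_plus_eq_self_iff:
  fixes h :: "'a::real_vector set"
  assumes "subspace h"
  shows "x +o h = h \<longleftrightarrow> x \<in> h"
  using elt_set_plus_eq_iff[OF assms, of x 0] by simp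

text \<open>Adding the zero cochain shows that \<theta> belongs to its own class, and by the
  vanishing of cohomology this class is the set of coboundaries.\<close>

lemma cocycles_subset_coboundaries:
  assumes h: "subspace h" and H: "cohomology_vanishes \<pi> h n" and z: "zero_cochain h n \<in> coboundaries \<pi> h n"
    and \<theta>: "\<theta> \<in> cocycles \<pi> h n"
  shows "\<theta> \<in> coboundaries \<pi> h n"
proof -
  let ?R = "{(\<theta>, \<theta>'). \<theta> \<in> cocycles \<pi> h n \<and> \<theta>' \<in> cocycles \<pi> h n \<and>
        (\<exists>\<beta>\<in>coboundaries \<pi> h n. \<theta>' = cochain_add h n \<theta> \<beta>)}"
  have fn: "\<theta> \<in> cochain_args h n \<rightarrow>\<^sub>E quot h" using \<theta> by (auto simp: cocycles_def cochains_def)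
  have "\<theta> = cochain_add h n \<theta> (zero_cochain h n)"
  proof
    fix a show "\<theta> a = cochain_add h n \<theta> (zero_cochain h n) a"
    proof (cases "a \<in> cochain_args h n")
      case True
      then obtain x where "\<theta> a = x +o h" using fn by (auto simp: quot_def)
      then show ?thesis
        using True quot_operations(1)[OF h, of x 0] by (simp add: cochain_add_def zero_cochain_def)
    next
      case False
      then show ?thesis using fn by (auto simp: cochain_add_def)
    qed
  qed
  then have "(\<theta>, \<theta>) \<in> ?R" using \<theta> z by blast
  then have "\<theta> \<in> ?R `` {\<theta>}" by (rule ImageI) simp
  moreover have "?R `` {\<theta>} \<in> cohomology \<pi> h n" unfolding cohomology_def using \<theta> by (rule quotientI)
  ultimately show ?thesis using H by (simp only: cohomology_vanishes_def singleton_iff)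
qed

lemma cochain_args_1: "a \<in> cochain_args h (Suc 0) \<longleftrightarrow> (\<exists>z\<in>h. a = ([], z))"
  by (auto simp: cochain_args_def)

lemma cochain_args_2: "a \<in> cochain_args h 2 \<longleftrightarrow> (\<exists>x\<in>h. \<exists>y\<in>h. \<exists>z\<in>h. a = ([(x, y)], z))"
  by (auto simp: cochain_args_def length_Suc_conv)

lemma cochain_args_3:
  "a \<in> cochain_args h 3 \<longleftrightarrow> (\<exists>u\<in>h. \<exists>v\<in>h. \<exists>x\<in>h. \<exists>y\<in>h. \<exists>z\<in>h. a = ([(u, v), (x, y)], z))"
  by (auto simp: cochain_args_def length_Suc_conv numeral_eq_Suc)

text \<open>A representative of the coboundary of a 2-cochain, with values in the ambient space
  instead of the quotient. The bracket and the cochain are separate arguments, so that the bracket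
  can be varied while the expression stays linear in \<theta>.\<close>

definition cocycle_defect ::
  "('a::real_vector \<Rightarrow> 'a \<Rightarrow> 'a \<Rightarrow> 'a) \<Rightarrow> ('a \<Rightarrow> 'a \<Rightarrow> 'a \<Rightarrow> 'a) \<Rightarrow> 'a \<Rightarrow> 'a \<Rightarrow> 'a \<Rightarrow> 'a \<Rightarrow> 'a \<Rightarrow> 'a" where
  "cocycle_defect \<pi> \<theta> u v x y z =
     \<theta> u v (\<pi> x y z) - \<theta> (\<pi> u v x) y z - \<theta> x (\<pi> u v y) z - \<theta> x y (\<pi> u v z)
     + \<pi> u v (\<theta> x y z) - \<pi> x y (\<theta> u v z) - \<pi> y z (\<theta> u v x) - \<pi> z x (\<theta> u v y)"

context
  fixes \<pi> :: "'a::real_vector \<Rightarrow> 'a \<Rightarrow> 'a \<Rightarrow> 'a" and h :: "'a set"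
  assumes \<pi>: "three_lie_algebra \<pi>" and h: "three_lie_subalgebra \<pi> h"
begin

lemma subspace_h: "subspace h"
  using h by (simp add: three_lie_subalgebra_def)

lemma closed_h: "x \<in> h \<Longrightarrow> y \<in> h \<Longrightarrow> z \<in> h \<Longrightarrow> \<pi> x y z \<in> h"
  using h by (simp add: three_lie_subalgebra_def)

lemmas quot_simps = quot_operations(1,2)[OF subspace_h] quot_operations(3)[OF subspace_h \<pi> h]

lemma coboundary_1:
  assumes \<psi>: "\<And>u. u \<in> h \<Longrightarrow> \<psi> ([], u) = g u +o h" and xyz: "x \<in> h" "y \<in> h" "z \<in> h"
  shows "coboundary \<pi> h 1 \<psi> ([(x, y)], z) = (\<pi> x y (g z) + \<pi> y z (g x) + \<pi> z x (g y) - g (\<pi> x y z)) +o h"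
proof -
  have "([(x, y)], z) \<in> cochain_args h (1 + 1)" using xyz by (simp add: cochain_args_def)
  then show ?thesis
    unfolding coboundary_def using xyz
    by (simp add: Let_def omit_def \<psi> closed_h quot_simps algebra_simps)
qed

lemma coboundary_2:
  assumes \<theta>: "\<And>x y z. x \<in> h \<Longrightarrow> y \<in> h \<Longrightarrow> z \<in> h \<Longrightarrow> \<Theta> ([(x, y)], z) = \<theta> x y z +o h"
    and xyz: "u \<in> h" "v \<in> h" "x \<in> h" "y \<in> h" "z \<in> h"
  shows "coboundary \<pi> h 2 \<Theta> ([(u, v), (x, y)], z) = cocycle_defect \<pi> \<theta> u v x y z +o h"
proof -
  have "([(u, v), (x, y)], z) \<in> cochain_args h (2 + 1)" using xyz by (simp add: cochain_args_def)
  moreover have "{1..2} = {1, 2 :: nat}" "{1..<2} = {1 :: nat}" by auto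
  ultimately show ?thesis
    unfolding coboundary_def using xyz
    by (simp add: Let_def omit_def \<theta> closed_h quot_simps cocycle_defect_def algebra_simps)
qed

lemma zero_in_coboundaries: "zero_cochain h 2 \<in> coboundaries \<pi> h 2"
proof -
  have "zero_cochain h 1 \<in> cochains h 1"
    using quot_simps(2)[of _ 0] quot_simps(1)[of 0 0] subspace_h
    by (auto simp: cochains_def zero_cochain_def cochain_args_1 linear_to_quot_def subspace_add subspace_scale
        intro!: image_eqI[of _ _ 0] simp: quot_def)
  moreover have "coboundary \<pi> h 1 (zero_cochain h 1) = zero_cochain h 2"
  proof
    fix a show "coboundary \<pi> h 1 (zero_cochain h 1) a = zero_cochain h 2 a"
    proof (cases "a \<in> cochain_args h 2")
      case True
      then obtain x y z where a: "a = ([(x, y)], z)" "x \<in> h" "y \<in> h" "z \<in> h"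
        by (auto simp: cochain_args_2)
      have "linear (\<pi> x y)" for x y using \<pi> unfolding three_lie_algebra_def Hom3_def by blast
      then have "\<pi> x y 0 = 0" for x y by (rule linear_0)
      then show ?thesis
        using coboundary_1[of "zero_cochain h 1" "\<lambda>_. 0"] True a
        by (simp add: zero_cochain_def cochain_args_1)
    next
      case False
      then show ?thesis by (simp add: coboundary_def zero_cochain_def numeral_2_eq_2)
    qed
  qed
  ultimately show ?thesis unfolding coboundaries_def
    by (intro image_eqI[where x = "zero_cochain h 1"]) simp_all
qed

text \<open>This translates the vanishing of cohomology from coset-valued cochains to linear maps of
  the ambient space, with \<open>p\<close> selecting a complement of \<open>h\<close> that
  represents the quotient.\<close>

lemma cocycle_eq_coboundary:
  assumes H: "cohomology_vanishes \<pi> h 2"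
    and \<theta>: "\<theta> \<in> Hom3"
    and cocycle: "\<And>u v x y z. u \<in> h \<Longrightarrow> v \<in> h \<Longrightarrow> x \<in> h \<Longrightarrow> y \<in> h \<Longrightarrow> z \<in> h \<Longrightarrow>
      cocycle_defect \<pi> \<theta> u v x y z \<in> h"
    and p: "linear p" "range p \<subseteq> h" "\<And>x. x \<in> h \<Longrightarrow> p x = x"
  obtains \<phi> where "linear \<phi>" "\<And>u. p (\<phi> u) = 0" "\<And>u. \<phi> (p u) = \<phi> u"
    "\<And>x y z. x \<in> h \<Longrightarrow> y \<in> h \<Longrightarrow> z \<in> h \<Longrightarrow>
    \<theta> x y z - (\<pi> x y (\<phi> z) + \<pi> y z (\<phi> x) + \<pi> z x (\<phi> y) - \<phi> (\<pi> x y z)) \<in> h"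
proof -
  note eq = elt_set_plus_eq_iff[OF subspace_h]
  define \<Theta> where "\<Theta> = restrict (\<lambda>(ps, z). \<theta> (fst (ps ! 0)) (snd (ps ! 0)) z +o h) (cochain_args h 2)"
  have \<Theta>: "\<Theta> ([(x, y)], z) = \<theta> x y z +o h" if "x \<in> h" "y \<in> h" "z \<in> h" for x y z
    using that by (simp add: \<Theta>_def cochain_args_def)
  have lin: "linear (\<lambda>x. \<theta> x y z)" "linear (\<lambda>y. \<theta> x y z)" "linear (\<lambda>z. \<theta> x y z)"
    and alt: "\<theta> x x y = 0" "\<theta> x y y = 0" for x y z
    using \<theta> by (auto simp: Hom3_def)
  have "\<Theta> \<in> cochains h 2"
    unfolding cochains_def
  proof (intro CollectI conjI ballI)
    show "\<Theta> \<in> cochain_args h 2 \<rightarrow>\<^sub>E quot h"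
      by (auto simp: \<Theta>_def quot_def)
    fix a assume "a \<in> cochain_args h 2"
    then obtain x y z where a: "a = ([(x, y)], z)" "x \<in> h" "y \<in> h" "z \<in> h"
      by (auto simp: cochain_args_2)
    then show "case a of (ps, z) \<Rightarrow> linear_to_quot h (\<lambda>u. \<Theta> (ps, u)) \<and>
      (\<forall>i < 2 - 1. linear_to_quot h (\<lambda>u. \<Theta> (ps[i := (u, snd (ps ! i))], z)) \<and>
        linear_to_quot h (\<lambda>u. \<Theta> (ps[i := (fst (ps ! i), u)], z)) \<and>
        (fst (ps ! i) = snd (ps ! i) \<longrightarrow> \<Theta> (ps, z) = h)) \<and>
      (ps \<noteq> [] \<and> snd (last ps) = z \<longrightarrow> \<Theta> (ps, z) = h)"
      using subspace_h
      by (simp add: linear_to_quot_def \<Theta> subspace_add subspace_scale quot_simps alt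
        linear_add[OF lin(1)] linear_scale[OF lin(1)] linear_add[OF lin(2)] linear_scale[OF lin(2)]
        linear_add[OF lin(3)] linear_scale[OF lin(3)])
  qed
  moreover have "coboundary \<pi> h 2 \<Theta> = zero_cochain h (2 + 1)"
  proof
    fix a show "coboundary \<pi> h 2 \<Theta> a = zero_cochain h (2 + 1) a"
    proof (cases "a \<in> cochain_args h 3")
      case True
      then obtain u v x y z where a: "a = ([(u, v), (x, y)], z)" "u \<in> h" "v \<in> h" "x \<in> h" "y \<in> h" "z \<in> h"
        by (auto simp: cochain_args_3)
      then show ?thesis
        using True coboundary_2[of \<Theta> \<theta>, OF \<Theta>] cocycle elt_set_plus_eq_self_iff[OF subspace_h]
        by (simp add: zero_cochain_def)
    next
      case False
      then show ?thesis by (simp add: coboundary_def zero_cochain_def)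
    qed
  qed
  ultimately have "\<Theta> \<in> cocycles \<pi> h 2" by (simp add: cocycles_def)
  then have "\<Theta> \<in> coboundaries \<pi> h 2"
    using cocycles_subset_coboundaries[OF subspace_h H zero_in_coboundaries] by blast
  then obtain \<psi> where \<psi>: "\<psi> \<in> cochains h 1" "\<Theta> = coboundary \<pi> h 1 \<psi>"
    by (auto simp: coboundaries_def)
  have "\<exists>w. \<psi> ([], u) = w +o h" if "u \<in> h" for u
  proof -
    have "([], u) \<in> cochain_args h 1" using that by (simp add: cochain_args_1)
    then have "\<psi> ([], u) \<in> quot h" using \<psi>(1) by (auto simp: cochains_def)
    then show ?thesis by (auto simp: quot_def)
  qed
  then obtain g where g: "\<And>u. u \<in> h \<Longrightarrow> \<psi> ([], u) = g u +o h" by metis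
  have "linear_to_quot h (\<lambda>u. \<psi> ([], u))"
  proof -
    have "([], 0) \<in> cochain_args h 1" using subspace_0[OF subspace_h] by (simp add: cochain_args_1)
    then show ?thesis using \<psi>(1) unfolding cochains_def by blast
  qed
  then have g_add: "g (u + v) - (g u + g v) \<in> h" and g_scale: "g (c *\<^sub>R u) - c *\<^sub>R g u \<in> h"
    if "u \<in> h" "v \<in> h" for u v c
    using that subspace_h
    by (auto simp: linear_to_quot_def g subspace_add subspace_scale quot_simps eq)
  \<comment> \<open>The chosen representatives \<open>g\<close> are linear only modulo
    \<open>h\<close>. Applying \<open>1 - p\<close>, which kills \<open>h\<close>, removes the
    ambiguity and gives a linear map; precomposing with \<open>p\<close> extends it from
    \<open>h\<close> to the whole space.\<close>
  define \<phi> where "\<phi> u = g (p u) - p (g (p u))" for u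
  have ph: "p u \<in> h" for u using p(2) by auto
  have "linear \<phi>"
  proof (rule linearI)
    fix u v and c :: real
    show "\<phi> (u + v) = \<phi> u + \<phi> v"
      using p(3)[OF g_add[OF ph ph, of u v]]
      by (simp add: \<phi>_def linear_add[OF p(1)] linear_diff[OF p(1)] algebra_simps)
    show "\<phi> (c *\<^sub>R u) = c *\<^sub>R \<phi> u"
      using p(3)[OF g_scale[OF ph ph, of c u]]
      by (simp add: \<phi>_def linear_scale[OF p(1)] linear_diff[OF p(1)] algebra_simps)
  qed
  moreover have \<psi>\<phi>: "\<psi> ([], u) = \<phi> u +o h" if "u \<in> h" for u
    using that ph by (simp add: g eq \<phi>_def p(3))
  then have "\<theta> x y z - (\<pi> x y (\<phi> z) + \<pi> y z (\<phi> x) + \<pi> z x (\<phi> y) - \<phi> (\<pi> x y z)) \<in> h"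
    if "x \<in> h" "y \<in> h" "z \<in> h" for x y z
    unfolding eq[symmetric] \<Theta>[OF that, symmetric] \<psi>(2) using that by (intro coboundary_1 \<psi>\<phi>)
  moreover have "p (\<phi> u) = 0" "\<phi> (p u) = \<phi> u" for u
    using ph by (simp_all add: \<phi>_def linear_diff[OF p(1)] p(3))
  ultimately show ?thesis using that by blast
qed

end


section \<open>Stability\<close>

text \<open>A basis of \<open>h\<close> gives a frame in the open preimage of the neighbourhood.
  This preimage contains a box around the frame within \<open>frames k\<close>, and the least of its
  finitely many radii gives \<open>e\<close>.\<close>

lemma Gr_neighbourhood_frame:
  fixes h :: "'a::real_normed_vector set"
  assumes fd: "finite_dimensional TYPE('a)" and V: "openin (Gr_topology k) \<V>" "h \<in> \<V>"
  obtains v e where "v \<in> frames k" "span (v ` {..<k}) = h" "e > 0"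
    "\<forall>w\<in>frames k. (\<forall>i<k. dist (w i) (v i) < e) \<longrightarrow> span (w ` {..<k}) \<in> \<V>"
proof -
  have Gr: "\<V> \<subseteq> Gr k" and op: "openin (frame_topology k) {v \<in> frames k. span (v ` {..<k}) \<in> \<V>}"
    using V(1) by (auto simp: openin_Gr_topology)
  have h: "subspace h" "dim h = k" using Gr V(2) by (auto simp: Gr_def)
  obtain B where B: "finite B" "independent B" "span B = h" "card B = k"
    using finite_dimensional_basis[OF fd h(1)] h(2) by metis
  obtain f where f: "bij_betw f {..<k} B"
    using ex_bij_betw_nat_finite[OF B(1)] B(4) by (auto simp: atLeast0LessThan)
  define v where "v = restrict f {..<k}"
  have v_im: "v ` {..<k} = B" using f by (simp add: v_def bij_betw_def)
  then have sp: "span (v ` {..<k}) = h" using B(3) by simp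
  have v: "v \<in> frames k"
  proof -
    have "inj_on v {..<k}" using f by (simp add: v_def bij_betw_def inj_on_restrict_eq)
    then show ?thesis using B(2) by (simp add: frames_def v_im) (simp add: v_def)
  qed
  obtain T where T: "openin (product_topology (\<lambda>_. euclidean) {..<k}) T"
    "{v \<in> frames k. span (v ` {..<k}) \<in> \<V>} = T \<inter> frames k"
    using op[unfolded frame_topology_def openin_subtopology] by (elim exE conjE) (rule that)
  have "v \<in> T" using T(2) v sp V(2) by blast
  obtain U where U: "\<And>i. i < k \<Longrightarrow> open (U i)" "v \<in> Pi\<^sub>E {..<k} U" "Pi\<^sub>E {..<k} U \<subseteq> T"
  proof -
    have "\<forall>x\<in>T. \<exists>U. (\<forall>i\<in>{..<k}. open (U i)) \<and> x \<in> Pi\<^sub>E {..<k} U \<and> Pi\<^sub>E {..<k} U \<subseteq> T"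
      using T(1) unfolding openin_product_topology_alt by auto
    from bspec[OF this \<open>v \<in> T\<close>] show ?thesis using that by blast
  qed
  have "\<exists>e>0. ball (v i) e \<subseteq> U i" if "i < k" for i
    using U(1)[OF that] U(2) that by (auto simp: open_contains_ball PiE_iff)
  then obtain E where E: "\<And>i. i < k \<Longrightarrow> E i > 0" "\<And>i. i < k \<Longrightarrow> ball (v i) (E i) \<subseteq> U i" by metis
  \<comment> \<open>The inserted 1 keeps the minimum meaningful for \<open>k = 0\<close>.\<close>
  define e where "e = Min (insert 1 (E ` {..<k}))"
  have "e > 0" unfolding e_def using E(1) by (subst Min_gr_iff) auto
  have e: "e \<le> E i" if "i < k" for i unfolding e_def using that by (intro Min_le) auto
  have "span (w ` {..<k}) \<in> \<V>" if w: "w \<in> frames k" "\<And>i. i < k \<Longrightarrow> dist (w i) (v i) < e" for w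
  proof -
    have "w i \<in> U i" if "i < k" for i
      using E(2)[OF that] e[OF that] w(2)[OF that] by (auto simp: subset_iff dist_commute)
    then have "w \<in> Pi\<^sub>E {..<k} U" using w(1) by (auto simp: frames_def PiE_iff)
    then have "w \<in> T" using U(3) by blast
    then show ?thesis using T(2) w(1) by blast
  qed
  then show ?thesis using that v sp \<open>e > 0\<close> by blast
qed

text \<open>The strict inequality \<open>c < d\<close> leaves room: half of \<open>d - c\<close> can
  be added to the bound by the triangle inequality.\<close>

lemma openin_Hom3_ball:
  fixes \<pi> :: "'a::real_normed_vector \<Rightarrow> 'a \<Rightarrow> 'a \<Rightarrow> 'a"
  shows "openin Hom3_topology {\<pi>' \<in> Hom3. \<exists>c. 0 \<le> c \<and> c < d \<and>
    (\<forall>x y z. norm (\<pi>' x y z - \<pi> x y z) \<le> c * norm x * norm y * norm z)}"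
  unfolding openin_Hom3_topology
proof (intro conjI ballI)
  fix \<pi>1 assume "\<pi>1 \<in> {\<pi>' \<in> Hom3. \<exists>c. 0 \<le> c \<and> c < d \<and>
    (\<forall>x y z. norm (\<pi>' x y z - \<pi> x y z) \<le> c * norm x * norm y * norm z)}"
  then obtain c where c: "0 \<le> c" "c < d"
    "\<And>x y z. norm (\<pi>1 x y z - \<pi> x y z) \<le> c * norm x * norm y * norm z" by blast
  let ?e = "(d - c) / 2"
  have "norm (\<pi>2 x y z - \<pi> x y z) \<le> (c + ?e) * norm x * norm y * norm z"
    if "norm (\<pi>2 x y z - \<pi>1 x y z) \<le> ?e * norm x * norm y * norm z" for \<pi>2 x y z
  proof -
    have "norm (\<pi>2 x y z - \<pi> x y z) \<le> norm (\<pi>2 x y z - \<pi>1 x y z) + norm (\<pi>1 x y z - \<pi> x y z)"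
      using norm_triangle_ineq[of "\<pi>2 x y z - \<pi>1 x y z" "\<pi>1 x y z - \<pi> x y z"] by simp
    also have "\<dots> \<le> ?e * norm x * norm y * norm z + c * norm x * norm y * norm z"
      by (intro add_mono that c(3))
    finally show ?thesis by (simp only: distrib_right add.commute)
  qed
  moreover have "?e > 0" "0 \<le> c + ?e" "c + ?e < d" using c by (auto simp: field_simps)
  ultimately show "\<exists>e>0. \<forall>\<pi>'\<in>Hom3. (\<forall>x y z. norm (\<pi>' x y z - \<pi>1 x y z) \<le> e * norm x * norm y * norm z) \<longrightarrow>
    \<pi>' \<in> {\<pi>' \<in> Hom3. \<exists>c. 0 \<le> c \<and> c < d \<and> (\<forall>x y z. norm (\<pi>' x y z - \<pi> x y z) \<le> c * norm x * norm y * norm z)}"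
    by (intro exI[of _ ?e]) blast
qed auto

section \<open>Transport of 3-Lie structures and the resulting cocycle equation\<close>

lemma Hom3_imp_trilinear: "\<pi> \<in> Hom3 \<Longrightarrow> trilinear \<pi>"
  by (simp add: Hom3_def trilinear_def)

text \<open>A cyclic rotation is a product of two transpositions, and each of them changes the sign
  by polarisation.\<close>

lemma Hom3_rotate:
  assumes "\<pi> \<in> Hom3"
  shows "\<pi> y z x = \<pi> x y z"
proof -
  have lin: "linear (\<lambda>x. \<pi> x y z)" "linear (\<lambda>y. \<pi> x y z)" "linear (\<lambda>z. \<pi> x y z)"
    and alt: "\<pi> x x y = 0" "\<pi> x y y = 0" for x y z
    using assms by (auto simp: Hom3_def)
  have "\<pi> x y z = - \<pi> y x z" for x y z
  proof -
    have "\<pi> (x + y) (x + y) z = \<pi> x x z + \<pi> x y z + (\<pi> y x z + \<pi> y y z)"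
      by (simp add: linear_add[OF lin(1)] linear_add[OF lin(2)])
    then have "\<pi> x y z + \<pi> y x z = 0" by (simp add: alt)
    then show ?thesis by (rule eq_neg_iff_add_eq_0[THEN iffD2])
  qed
  moreover have "\<pi> x y z = - \<pi> x z y" for x y z
  proof -
    have "\<pi> x (y + z) (y + z) = \<pi> x y y + \<pi> x y z + (\<pi> x z y + \<pi> x z z)"
      by (simp add: linear_add[OF lin(2)] linear_add[OF lin(3)])
    then have "\<pi> x y z + \<pi> x z y = 0" by (simp add: alt)
    then show ?thesis by (rule eq_neg_iff_add_eq_0[THEN iffD2])
  qed
  ultimately have "\<pi> y z x = - \<pi> y x z" "\<pi> x y z = - \<pi> y x z" by blast+
  then show ?thesis by simp
qed

text \<open>As \<phi> squares to zero, \<open>1 + \<phi>\<close> has the inverse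
  \<open>1 - \<phi>\<close> and intertwines the two brackets, so the fundamental identity is
  transported along an isomorphism.\<close>

lemma three_lie_algebra_conj_act:
  fixes \<phi> :: "'a::real_normed_vector \<Rightarrow>\<^sub>L 'a"
  assumes fd: "finite_dimensional TYPE('a)" and \<tau>: "three_lie_algebra (apply3 \<tau>)"
    and \<phi>: "\<And>x. \<phi> (\<phi> x) = 0"
  shows "three_lie_algebra (apply3 (conj_act \<phi> \<tau>))"
proof -
  let ?\<sigma> = "apply3 (conj_act \<phi> \<tau>)" and ?g = "\<lambda>x. x + blinfun_apply \<phi> x"
  have \<sigma>: "?\<sigma> x y z = apply3 \<tau> (?g x) (?g y) (?g z) - \<phi> (apply3 \<tau> (?g x) (?g y) (?g z))" for x y z
    by (rule apply3_conj_act[OF fd])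
  have g\<sigma>: "?g (?\<sigma> x y z) = apply3 \<tau> (?g x) (?g y) (?g z)" for x y z
    unfolding \<sigma> by (simp add: blinfun.bilinear_simps \<phi>)
  have FI: "apply3 \<tau> x1 x2 (apply3 \<tau> x3 x4 x5) =
      apply3 \<tau> (apply3 \<tau> x1 x2 x3) x4 x5 + apply3 \<tau> x3 (apply3 \<tau> x1 x2 x4) x5 + apply3 \<tau> x3 x4 (apply3 \<tau> x1 x2 x5)"
    for x1 x2 x3 x4 x5
    using \<tau> unfolding three_lie_algebra_def by blast
  have "?\<sigma> \<in> Hom3"
  proof -
    have "apply3 \<tau> \<in> Hom3" using \<tau> unfolding three_lie_algebra_def by blast
    then have "apply3 \<tau> x x y = 0" "apply3 \<tau> x y y = 0" "apply3 \<tau> x y x = 0" for x y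
      unfolding Hom3_def by blast+
    then have "?\<sigma> x x y = 0" "?\<sigma> x y y = 0" "?\<sigma> x y x = 0" for x y
      unfolding \<sigma> by (simp_all add: blinfun.zero_right)
    then show ?thesis using trilinear_apply3[of "conj_act \<phi> \<tau>"] unfolding Hom3_def trilinear_def by blast
  qed
  moreover have "?\<sigma> x1 x2 (?\<sigma> x3 x4 x5) =
        ?\<sigma> (?\<sigma> x1 x2 x3) x4 x5 + ?\<sigma> x3 (?\<sigma> x1 x2 x4) x5 + ?\<sigma> x3 x4 (?\<sigma> x1 x2 x5)" for x1 x2 x3 x4 x5
    unfolding \<sigma>[of x1 x2 "?\<sigma> x3 x4 x5"] \<sigma>[of "?\<sigma> x1 x2 x3"] \<sigma>[of x3 "?\<sigma> x1 x2 x4"] \<sigma>[of x3 x4 "?\<sigma> x1 x2 x5"] g\<sigma>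
    unfolding FI[of "?g x1" "?g x2"] by (simp add: blinfun.add_right)
  ultimately show ?thesis unfolding three_lie_algebra_def by blast
qed

text \<open>
  If \<open>P\<close> is a projection onto \<open>h\<close>, then \<open>1 - P\<close> identifies the quotient by \<open>h\<close> with the kernel of \<open>P\<close>, and
  this is the class of \<open>\<tau>\<close> in \<open>Hom(\<wedge>\<^sup>3 h, \<gg>/h)\<close>.
\<close>

definition normal_part :: "('a::real_normed_vector \<Rightarrow>\<^sub>L 'a) \<Rightarrow> 'a blinfun3 \<Rightarrow> 'a blinfun3" where
  "normal_part P \<tau> = Blinfun3 (\<lambda>x y z. let w = apply3 \<tau> (P x) (P y) (P z) in w - P w)"

lemma apply3_normal_part:
  fixes P :: "'a::real_normed_vector \<Rightarrow>\<^sub>L 'a"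
  assumes fd: "finite_dimensional TYPE('a)"
  shows "apply3 (normal_part P \<tau>) x y z = apply3 \<tau> (P x) (P y) (P z) - P (apply3 \<tau> (P x) (P y) (P z))"
  unfolding normal_part_def
  by (subst apply3_Blinfun3[OF fd])
    (auto simp: trilinear_def Let_def blinfun.bilinear_simps algebra_simps intro!: linearI)

text \<open>For each of the four nested brackets, the term with an inner bracket inside
  \<open>normal_part\<close> contributes its component in the image of \<open>P\<close>, and the
  term with an outer bracket the complementary one. Modulo the image of \<open>P\<close> they add up
  to the fundamental identity for \<sigma>; \<sigma> itself may fail to preserve that image.\<close>

lemma normal_part_cocycle:
  fixes P :: "'a::real_normed_vector \<Rightarrow>\<^sub>L 'a"
  assumes fd: "finite_dimensional TYPE('a)" and \<sigma>: "three_lie_algebra (apply3 \<sigma>)"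
    and P: "\<And>x. P (P x) = P x"
    and fixed: "P u = u" "P v = v" "P x = x" "P y = y" "P z = z"
  shows "cocycle_defect (apply3 \<sigma>) (apply3 (normal_part P \<sigma>)) u v x y z =
    P (cocycle_defect (apply3 \<sigma>) (apply3 (normal_part P \<sigma>)) u v x y z)"
proof -
  let ?\<sigma> = "apply3 \<sigma>" and ?q = "\<lambda>x. x - P x"
  have rot: "?\<sigma> y z x = ?\<sigma> x y z" for x y z
    using \<sigma> unfolding three_lie_algebra_def by (intro Hom3_rotate) (rule conjunct1)
  have FI: "?\<sigma> u v (?\<sigma> x y z) = ?\<sigma> (?\<sigma> u v x) y z + ?\<sigma> x (?\<sigma> u v y) z + ?\<sigma> x y (?\<sigma> u v z)"
    using \<sigma> unfolding three_lie_algebra_def by blast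
  have "?q (cocycle_defect ?\<sigma> (apply3 (normal_part P \<sigma>)) u v x y z) =
      ?q (?\<sigma> u v (?\<sigma> x y z) - ?\<sigma> y z (?\<sigma> u v x) - ?\<sigma> z x (?\<sigma> u v y) - ?\<sigma> x y (?\<sigma> u v z))"
    by (simp add: cocycle_defect_def apply3_normal_part[OF fd] fixed P blinfun.bilinear_simps
      rot[of y z "P (?\<sigma> u v x)"] rot[of x "P (?\<sigma> u v y)" z])
  also have "\<dots> = 0"
    using FI rot[of y z "?\<sigma> u v x"] rot[of x "?\<sigma> u v y" z] by (simp add: blinfun.zero_right)
  finally show ?thesis by simp
qed


section \<open>Finding the deformed subalgebra\<close>

lemma exists_linear_projection:
  fixes h :: "'a::real_vector set"
  assumes "subspace h"
  obtains p :: "'a \<Rightarrow> 'a" where "linear p" "range p \<subseteq> h" "\<And>x. x \<in> h \<Longrightarrow> p x = x"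
proof -
  obtain p :: "'a \<Rightarrow> 'a" where "range p \<subseteq> h" "linear p" "\<forall>v\<in>h. p (id v) = v"
    using linear_exists_left_inverse_on[OF linear_id assms] by auto
  then show ?thesis using that by auto
qed

text \<open>The subspace \<open>h\<close> is held fixed and the structure is moved instead, so that
  all equations live in a single vector space.\<close>

lemma nearby_conj_act_preserves_subalgebra:
  fixes \<pi> :: "'a::real_normed_vector \<Rightarrow> 'a \<Rightarrow> 'a \<Rightarrow> 'a" and h :: "'a set"
  assumes fd: "finite_dimensional TYPE('a)"
    and \<pi>: "three_lie_algebra \<pi>" and sub: "three_lie_subalgebra \<pi> h"
    and H: "cohomology_vanishes \<pi> h 2" and e: "e > 0"
  obtains d where "d > 0"
    "\<And>\<tau>. three_lie_algebra (apply3 \<tau>) \<Longrightarrow> dist \<tau> (Blinfun3 \<pi>) < d \<Longrightarrow>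
      \<exists>\<phi>. norm \<phi> < e \<and> (\<forall>x. blinfun_apply \<phi> (blinfun_apply \<phi> x) = 0) \<and> three_lie_subalgebra (apply3 (conj_act \<phi> \<tau>)) h"
proof -
  have fdA: "finite_dimensional TYPE('a \<Rightarrow>\<^sub>L 'a)" and fdE: "finite_dimensional TYPE('a blinfun3)"
    using fd by (auto intro!: finite_dimensional_blinfun)
  have \<pi>_Hom3: "\<pi> \<in> Hom3" using \<pi> unfolding three_lie_algebra_def by (rule conjunct1)
  define p where "p = Blinfun3 \<pi>"
  have p: "apply3 p x y z = \<pi> x y z" for x y z
    unfolding p_def by (rule apply3_Blinfun3[OF fd Hom3_imp_trilinear[OF \<pi>_Hom3]])
  then have p_eq: "apply3 p = \<pi>" by (intro ext)
  have h: "subspace h" and \<pi>h: "\<And>x y z. x \<in> h \<Longrightarrow> y \<in> h \<Longrightarrow> z \<in> h \<Longrightarrow> \<pi> x y z \<in> h"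
    using sub unfolding three_lie_subalgebra_def by blast+
  obtain p0 :: "'a \<Rightarrow> 'a" where p0: "linear p0" "range p0 \<subseteq> h" "\<And>x. x \<in> h \<Longrightarrow> p0 x = x"
    using exists_linear_projection[OF h] by blast
  define P where "P = Blinfun p0"
  have P: "blinfun_apply P = p0" unfolding P_def using Blinfun_apply_linear[OF fd p0(1)] by (intro ext)
  have Ph: "P x \<in> h" and P_id: "x \<in> h \<Longrightarrow> P x = x" and PP: "P (P x) = P x" for x
    using p0 by (auto simp: P)
  let ?res = "normal_part P"
  have res: "apply3 (?res \<tau>) x y z = apply3 \<tau> (P x) (P y) (P z) - P (apply3 \<tau> (P x) (P y) (P z))" for \<tau> x y z
    by (rule apply3_normal_part[OF fd])
  have lin_res: "linear ?res"
    by (intro linearI blinfun3_eqI) (simp_all add: res blinfun.bilinear_simps algebra_simps)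
  have res_p: "?res p = 0"
    by (intro blinfun3_eqI) (simp add: res p P_id \<pi>h Ph)
  \<comment> \<open>\<open>N\<close> cuts \<phi> down to its block from \<open>h\<close> to the
    kernel of \<open>P\<close>. Such blocks square to zero, so \<open>conj_act\<close> is a genuine
    pullback along them.\<close>
  define N where "N \<phi> = Blinfun (\<lambda>x. blinfun_apply \<phi> (P x) - P (blinfun_apply \<phi> (P x)))" for \<phi>
  have N: "N \<phi> x = \<phi> (P x) - P (\<phi> (P x))" for \<phi> x
    unfolding N_def by (rule Blinfun_apply_linear[OF fd]) (auto intro!: linearI simp: blinfun.bilinear_simps algebra_simps)
  have lin_N: "linear N"
    by (intro linearI blinfun_eqI) (simp_all add: N blinfun.bilinear_simps algebra_simps)
  have lin_deriv: "linear (conj_act_deriv p)"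
    using strictly_differentiable_conj_act[OF fd, of p]
    unfolding strictly_differentiable_def by (blast intro: bounded_linear.linear)
  \<comment> \<open>This is the coboundary from degree 1 to degree 2 in terms of representatives.
    Its image \<open>K\<close> consists of the coboundaries, and the kernel of the projection
    \<open>Q\<close> is the fixed complement.\<close>
  define L where "L \<phi> = ?res (conj_act_deriv p (N \<phi>))" for \<phi>
  have lin_L: "linear L"
    using linear_compose[OF linear_compose[OF lin_N lin_deriv] lin_res] by (simp add: L_def[abs_def] o_def)
  define K where "K = range L"
  have K: "subspace K" unfolding K_def by (rule linear_subspace_image[OF lin_L subspace_UNIV])
  obtain Q :: "'a blinfun3 \<Rightarrow> 'a blinfun3" where Q: "linear Q" "range Q \<subseteq> K" "\<And>k. k \<in> K \<Longrightarrow> Q k = k"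
    using exists_linear_projection[OF K] by blast
  \<comment> \<open>A linear section of \<open>L\<close> over \<open>K\<close>; composed with
    \<open>N\<close>, it gives the parametrisation \<open>a\<close> of deformations that the
    contraction lemma requires.\<close>
  obtain R where R: "linear R" "\<And>k. k \<in> K \<Longrightarrow> L (R k) = k"
    using linear_exists_right_inverse_on[OF lin_L subspace_UNIV] unfolding K_def by blast
  define a where "a k = N (R k)" for k
  have bl_a: "bounded_linear a"
    unfolding a_def by (rule linear_imp_bounded_linear[OF fdE])
      (use linear_compose[OF R(1) lin_N] in \<open>simp add: o_def\<close>)
  define J where "J \<tau> = Q (?res \<tau>)" for \<tau>
  have bl_J: "bounded_linear J"
    unfolding J_def by (rule linear_imp_bounded_linear[OF fdE])
      (use linear_compose[OF lin_res Q(1)] in \<open>simp add: o_def\<close>)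
  have J_inv: "J (conj_act_deriv p (a k)) = k" if "k \<in> K" for k
    using R(2)[OF that] Q(3)[OF that] by (simp add: J_def a_def L_def)

  \<comment> \<open>Alternating maps that are their own normal part, and thus stand for 2-cochains,
    restricted to the complement of the coboundaries.\<close>
  define M where "M = {m :: 'a blinfun3. ?res m = m \<and> Q m = 0 \<and>
    (\<forall>x y. apply3 m x x y = 0 \<and> apply3 m x y y = 0 \<and> apply3 m x y x = 0)}"
  have M: "subspace M"
    unfolding subspace_def M_def
    by (auto simp: linear_0[OF lin_res] linear_add[OF lin_res] linear_scale[OF lin_res]
        linear_0[OF Q(1)] linear_add[OF Q(1)] linear_scale[OF Q(1)] blinfun.bilinear_simps)
  \<comment> \<open>The cocycle equation modulo \<open>h\<close>, one component for each quintuple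
    of arguments, with \<sigma> as coefficient and \<open>m\<close> as unknown.\<close>
  define G where "G = (\<lambda>(u, v, x, y, z) (\<sigma> :: 'a blinfun3) (m :: 'a blinfun3).
    cocycle_defect (apply3 \<sigma>) (apply3 m) u v x y z - P (cocycle_defect (apply3 \<sigma>) (apply3 m) u v x y z))"
  have M_zero: "m = 0" if m: "m \<in> M" "\<And>t. t \<in> h \<times> h \<times> h \<times> h \<times> h \<Longrightarrow> G t p m = 0" for m
  proof -
    have "cocycle_defect \<pi> (apply3 m) u v x y z \<in> h"
      if "u \<in> h" "v \<in> h" "x \<in> h" "y \<in> h" "z \<in> h" for u v x y z
    proof -
      have "G (u, v, x, y, z) p m = 0" using that by (intro m(2)) simp
      then have "cocycle_defect \<pi> (apply3 m) u v x y z = P (cocycle_defect \<pi> (apply3 m) u v x y z)"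
        by (simp add: G_def p_eq)
      then show ?thesis using Ph by metis
    qed
    moreover have "apply3 m \<in> Hom3"
      using m(1) trilinear_apply3[of m] unfolding Hom3_def trilinear_def M_def by blast
    ultimately obtain \<phi> where \<phi>: "linear \<phi>" "\<And>u. p0 (\<phi> u) = 0" "\<And>u. \<phi> (p0 u) = \<phi> u"
      "\<And>x y z. x \<in> h \<Longrightarrow> y \<in> h \<Longrightarrow> z \<in> h \<Longrightarrow>
        apply3 m x y z - (\<pi> x y (\<phi> z) + \<pi> y z (\<phi> x) + \<pi> z x (\<phi> y) - \<phi> (\<pi> x y z)) \<in> h"
      using cocycle_eq_coboundary[OF \<pi> sub H _ _ p0, of "apply3 m"] by blast
    have \<phi>': "blinfun_apply (Blinfun \<phi>) x = \<phi> x" for x by (rule Blinfun_apply_linear[OF fd \<phi>(1)])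
    have N\<phi>: "N (Blinfun \<phi>) = Blinfun \<phi>"
      by (intro blinfun_eqI) (simp add: N \<phi>' P \<phi>(2,3))
    have rot: "\<pi> y z x = \<pi> x y z" for x y z by (rule Hom3_rotate[OF \<pi>_Hom3])
    have P_cancel: "w - P w = b - P b" if "b - w = P (b - w)" for b w
      using that by (simp add: blinfun.diff_right algebra_simps)
    have "L (Blinfun \<phi>) = m"
    proof (rule blinfun3_eqI)
      fix x y z
      let ?x = "P x" and ?y = "P y" and ?z = "P z"
      let ?w = "\<pi> ?x ?y (\<phi> ?z) + \<pi> ?y ?z (\<phi> ?x) + \<pi> ?z ?x (\<phi> ?y) - \<phi> (\<pi> ?x ?y ?z)"
      have "apply3 m ?x ?y ?z - ?w = P (apply3 m ?x ?y ?z - ?w)" using \<phi>(4)[OF Ph Ph Ph] P_id by simp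
      then have "?w - P ?w = apply3 m ?x ?y ?z - P (apply3 m ?x ?y ?z)" by (rule P_cancel)
      also have "\<dots> = apply3 (?res m) x y z" by (simp add: res)
      also have "?res m = m" using m(1) by (simp add: M_def)
      moreover have "apply3 (conj_act_deriv p (N (Blinfun \<phi>))) ?x ?y ?z = ?w"
        unfolding N\<phi> apply3_conj_act_deriv[OF fd] \<phi>' p
        using rot[of ?y ?z "\<phi> ?x"] rot[of ?x "\<phi> ?y" ?z] by (simp add: algebra_simps)
      ultimately show "apply3 (L (Blinfun \<phi>)) x y z = apply3 m x y z"
        by (simp add: L_def res)
    qed
    \<comment> \<open>As a coboundary, \<open>m\<close> is fixed by \<open>Q\<close>, whereas
      membership in \<open>M\<close> says that \<open>Q\<close> kills it.\<close>
    then have "Q m = m" using Q(3) unfolding K_def by blast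
    then show ?thesis using m(1) by (simp add: M_def)
  qed
  have G_cont: "(\<lambda>n. G t (s n) (m n)) \<longlonglongrightarrow> G t p m0"
    if "s \<longlonglongrightarrow> p" "m \<longlonglongrightarrow> m0" for t and s m :: "nat \<Rightarrow> 'a blinfun3" and m0
    using that unfolding G_def cocycle_defect_def by (cases t) (auto intro!: tendsto_intros)
  have G_scale: "G t s (c *\<^sub>R m) = c *\<^sub>R G t s m" for t s c m
    unfolding G_def cocycle_defect_def by (cases t) (simp add: blinfun.bilinear_simps algebra_simps)
  obtain d1 where d1: "d1 > 0" "\<And>s m. dist s p < d1 \<Longrightarrow> m \<in> M \<Longrightarrow>
      (\<And>t. t \<in> h \<times> h \<times> h \<times> h \<times> h \<Longrightarrow> G t s m = 0) \<Longrightarrow> m = 0"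
    by (rule injective_family_nearby[OF fdE M, where G = G and p = p and T = "h \<times> h \<times> h \<times> h \<times> h"])
      (use G_cont G_scale M_zero in blast)+

  obtain d2 where d2: "d2 > 0"
    "\<And>\<phi> \<tau>. norm \<phi> < d2 \<Longrightarrow> dist \<tau> p < d2 \<Longrightarrow> dist (conj_act \<phi> \<tau>) p < d1"
    by (rule strictly_differentiableD[OF strictly_differentiable_conj_act[OF fd, of p] d1(1)]) (rule that; assumption)
  obtain A where A: "A > 0" "\<And>k. norm (a k) \<le> norm k * A"
    using bounded_linear.pos_bounded[OF bl_a] by blast
  \<comment> \<open>Halving makes the inequalities strict: \<open>norm k \<le> r\<close> then forces
    both \<open>norm (a k) < e\<close> and closeness of the pulled back structure to
    \<open>p\<close>.\<close>
  define r where "r = min e d2 / (2 * A)"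
  have r: "r > 0" "r * A < e" "r * A < d2" using e d2(1) A(1) by (auto simp: r_def min_def field_simps)
  have act_0: "conj_act 0 \<tau> = \<tau>" for \<tau> :: "'a blinfun3"
    by (intro blinfun3_eqI) (simp add: apply3_conj_act[OF fd])
  have J_range: "range J \<subseteq> K" using Q(2) by (auto simp: J_def)
  have J_p: "J p = 0" by (simp add: J_def res_p linear_0[OF Q(1)])
  obtain d3 where d3: "d3 > 0"
    "\<And>\<tau>. dist \<tau> p < d3 \<Longrightarrow> \<exists>k\<in>K. norm k \<le> r \<and> J (conj_act (a k) \<tau>) = 0"
    by (rule solve_by_contraction[OF fdE K strictly_differentiable_conj_act[OF fd] act_0 bl_J J_range J_p bl_a _ r(1)])
      (erule J_inv, (rule that; assumption))
  show ?thesis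
  proof (rule that)
    show "min d2 d3 > 0" using d2 d3 by simp
    fix \<tau> :: "'a blinfun3" assume \<tau>: "three_lie_algebra (apply3 \<tau>)" "dist \<tau> (Blinfun3 \<pi>) < min d2 d3"
    then obtain k where k: "k \<in> K" "norm k \<le> r" "J (conj_act (a k) \<tau>) = 0"
      using d3(2)[of \<tau>] by (auto simp: p_def)
    define \<phi> where "\<phi> = a k"
    define \<sigma> where "\<sigma> = conj_act \<phi> \<tau>"
    have norm_\<phi>: "norm \<phi> \<le> r * A"
      unfolding \<phi>_def using order_trans[OF A(2) mult_right_mono[OF k(2)]] A(1) by simp
    \<comment> \<open>Since \<phi> factors through \<open>P\<close> and takes values in the kernel
      of \<open>P\<close>, its square is zero.\<close>
    have "P (\<phi> x) = 0" and "\<phi> x = \<phi> (P x)" for x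
      by (simp_all add: \<phi>_def a_def N PP blinfun.diff_right)
    then have \<phi>\<phi>: "\<phi> (\<phi> x) = 0" for x by (metis blinfun.zero_right)
    have \<sigma>: "three_lie_algebra (apply3 \<sigma>)"
      unfolding \<sigma>_def by (rule three_lie_algebra_conj_act[OF fd \<tau>(1) \<phi>\<phi>])
    have \<sigma>_near: "dist \<sigma> p < d1"
      unfolding \<sigma>_def using norm_\<phi> r(3) \<tau>(2) by (intro d2(2)) (auto simp: p_def)
    have "apply3 \<sigma> \<in> Hom3" using \<sigma> unfolding three_lie_algebra_def by (rule conjunct1)
    then have alt: "apply3 \<sigma> x x y = 0" "apply3 \<sigma> x y y = 0" "apply3 \<sigma> x y x = 0" for x y
      unfolding Hom3_def by blast+
    have "?res (?res \<sigma>) = ?res \<sigma>"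
      by (intro blinfun3_eqI) (simp add: res PP blinfun.diff_right)
    \<comment> \<open>The contraction has removed exactly the component in \<open>K\<close>; the
      cocycle equation for \<sigma> disposes of the rest.\<close>
    moreover have "Q (?res \<sigma>) = 0" using k(3) by (simp add: J_def \<sigma>_def \<phi>_def)
    ultimately have "?res \<sigma> \<in> M" by (simp add: M_def res alt blinfun.zero_right)
    moreover have "G t \<sigma> (?res \<sigma>) = 0" if "t \<in> h \<times> h \<times> h \<times> h \<times> h" for t
    proof -
      obtain u v x y z where t: "t = (u, v, x, y, z)" "u \<in> h" "v \<in> h" "x \<in> h" "y \<in> h" "z \<in> h"
        using \<open>t \<in> _\<close> by auto
      show ?thesis
        using normal_part_cocycle[OF fd \<sigma> PP P_id[OF t(2)] P_id[OF t(3)] P_id[OF t(4)] P_id[OF t(5)] P_id[OF t(6)]]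
        by (simp add: G_def t(1))
    qed
    ultimately have res_0: "?res \<sigma> = 0" using d1(2)[OF \<sigma>_near] by blast
    have "apply3 \<sigma> x y z \<in> h" if "x \<in> h" "y \<in> h" "z \<in> h" for x y z
    proof -
      have "apply3 (?res \<sigma>) x y z = 0" by (simp add: res_0)
      then have "apply3 \<sigma> x y z = P (apply3 \<sigma> x y z)" using that by (simp add: res P_id)
      then show ?thesis using Ph by metis
    qed
    then show "\<exists>\<phi>. norm \<phi> < e \<and> (\<forall>x. blinfun_apply \<phi> (blinfun_apply \<phi> x) = 0) \<and>
        three_lie_subalgebra (apply3 (conj_act \<phi> \<tau>)) h"
      using norm_\<phi> r(2) \<phi>\<phi> h unfolding three_lie_subalgebra_def \<sigma>_def by (intro exI[of _ \<phi>]) auto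
  qed
qed

theorem theorem5p5:
  fixes \<pi> :: "'a::real_normed_vector \<Rightarrow> 'a \<Rightarrow> 'a \<Rightarrow> 'a" and h :: "'a set" and k :: nat
  assumes "finite_dimensional TYPE('a)"
    and "three_lie_algebra \<pi>"
    and "three_lie_subalgebra \<pi> h" and "dim h = k"
    and "cohomology_vanishes \<pi> h 2"
  shows "stable_subalgebra k \<pi> h"
  unfolding stable_subalgebra_def
proof (intro allI impI, elim conjE)
  fix \<V> assume V: "openin (Gr_topology k) \<V>" "h \<in> \<V>"
  note fd = assms(1)
  have \<pi>_Hom3: "\<pi> \<in> Hom3" using assms(2) unfolding three_lie_algebra_def by (rule conjunct1)
  have h: "subspace h" using assms(3) by (simp add: three_lie_subalgebra_def)
  obtain v e where v: "v \<in> frames k" "span (v ` {..<k}) = h" and e: "e > 0"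
    "\<forall>w\<in>frames k. (\<forall>i<k. dist (w i) (v i) < e) \<longrightarrow> span (w ` {..<k}) \<in> \<V>"
    by (rule Gr_neighbourhood_frame[OF fd V])
  \<comment> \<open>A common bound for the frame vectors, with the summand 1 making it positive. A
    map \<phi> of norm below \<open>e / B\<close> then moves each of them by less than
    \<open>e\<close>.\<close>
  define B where "B = 1 + (\<Sum>i<k. norm (v i))"
  have B: "norm (v i) \<le> B" if "i < k" for i
    unfolding B_def using member_le_sum[of i "{..<k}" "\<lambda>i. norm (v i)"] that by simp
  have "B > 0" unfolding B_def by (simp add: add_pos_nonneg sum_nonneg)
  then have eB: "e / B > 0" using e(1) by simp
  obtain d where d: "d > 0" "\<And>\<tau>. three_lie_algebra (apply3 \<tau>) \<Longrightarrow> dist \<tau> (Blinfun3 \<pi>) < d \<Longrightarrow>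
      \<exists>\<phi>. norm \<phi> < e / B \<and> (\<forall>x. blinfun_apply \<phi> (blinfun_apply \<phi> x) = 0) \<and> three_lie_subalgebra (apply3 (conj_act \<phi> \<tau>)) h"
    by (rule nearby_conj_act_preserves_subalgebra[OF fd assms(2,3,5) eB]) (rule that; assumption)
  let ?W = "{\<pi>' \<in> Hom3. \<exists>c. 0 \<le> c \<and> c < d \<and>
    (\<forall>x y z. norm (\<pi>' x y z - \<pi> x y z) \<le> c * norm x * norm y * norm z)}"
  have "\<exists>h'\<in>\<V>. three_lie_subalgebra \<pi>' h'" if \<pi>': "\<pi>' \<in> ?W" "three_lie_algebra \<pi>'" for \<pi>'
  proof -
    obtain c where c: "0 \<le> c" "c < d" "\<And>x y z. norm (\<pi>' x y z - \<pi> x y z) \<le> c * norm x * norm y * norm z"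
      and \<pi>'_Hom3: "\<pi>' \<in> Hom3"
      using \<pi>'(1) by blast
    define \<tau> where "\<tau> = Blinfun3 \<pi>'"
    have \<tau>: "apply3 \<tau> x y z = \<pi>' x y z" for x y z
      unfolding \<tau>_def by (rule apply3_Blinfun3[OF fd Hom3_imp_trilinear[OF \<pi>'_Hom3]])
    then have \<tau>_eq: "apply3 \<tau> = \<pi>'" by (intro ext)
    have "norm (\<tau> - Blinfun3 \<pi>) \<le> c"
      using c(3) by (intro norm_blinfun3_le c(1))
        (simp add: blinfun.diff_left \<tau> apply3_Blinfun3[OF fd Hom3_imp_trilinear[OF \<pi>_Hom3]])
    then have "dist \<tau> (Blinfun3 \<pi>) < d" using c(2) by (simp add: dist_norm)
    then obtain \<phi> where \<phi>: "norm \<phi> < e / B" "\<And>x. blinfun_apply \<phi> (blinfun_apply \<phi> x) = 0"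
      "three_lie_subalgebra (apply3 (conj_act \<phi> \<tau>)) h"
      using d(2)[of \<tau>] \<pi>'(2) unfolding \<tau>_eq by blast
    define g where "g x = x + blinfun_apply \<phi> x" for x
    have lin_g: "linear g" by (rule linearI) (simp_all add: g_def blinfun.bilinear_simps algebra_simps)
    have "g x - blinfun_apply \<phi> (g x) = x" for x by (simp add: g_def blinfun.add_right \<phi>(2))
    then have inj_g: "inj g" by (metis injI)
    have "g (apply3 (conj_act \<phi> \<tau>) x y z) = \<pi>' (g x) (g y) (g z)" for x y z
      by (simp add: g_def apply3_conj_act[OF fd] blinfun.diff_right \<phi>(2) \<tau>)
    then have "three_lie_subalgebra \<pi>' (g ` h)"
      using \<phi>(3) linear_subspace_image[OF lin_g h] unfolding three_lie_subalgebra_def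
      by (auto simp: image_iff) metis
    moreover have "g ` h \<in> \<V>"
    proof -
      \<comment> \<open>The image frame has to be restricted, because elements of
        \<open>frames k\<close> are extensional.\<close>
      define w where "w = restrict (g \<circ> v) {..<k}"
      have w_im: "w ` {..<k} = g ` (v ` {..<k})" by (auto simp: w_def)
      have "inj_on (g \<circ> v) {..<k}"
        using v(1) inj_g by (intro comp_inj_on) (auto simp: frames_def intro: inj_on_subset)
      moreover have "independent (g ` (v ` {..<k}))"
        using v(1) by (intro linear_independent_injective_image[OF lin_g] inj_on_subset[OF inj_g]) (auto simp: frames_def)
      ultimately have "w \<in> frames k"
      proof -
        assume *: "inj_on (g \<circ> v) {..<k}" "independent (g ` (v ` {..<k}))"
        have "inj_on w {..<k}" using *(1) by (simp add: w_def inj_on_restrict_eq)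
        then show ?thesis using *(2) by (simp add: frames_def w_im) (simp add: w_def)
      qed
      moreover have "dist (w i) (v i) < e" if i: "i < k" for i
      proof -
        have "dist (w i) (v i) = norm (blinfun_apply \<phi> (v i))" using i by (simp add: w_def g_def dist_norm)
        also have "\<dots> \<le> norm \<phi> * norm (v i)" by (rule norm_blinfun)
        also have "\<dots> \<le> norm \<phi> * B" using B[OF i] by (intro mult_left_mono) auto
        also have "\<dots> < e" using \<phi>(1) \<open>B > 0\<close> by (simp add: pos_less_divide_eq)
        finally show ?thesis .
      qed
      ultimately have "span (w ` {..<k}) \<in> \<V>" using e(2) by blast
      then show ?thesis unfolding w_im linear_span_image[OF lin_g] v(2) .
    qed
    ultimately show ?thesis by blast
  qed
  moreover have "\<pi> \<in> ?W" using \<pi>_Hom3 d(1) by (auto intro: exI[of _ 0])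
  moreover have "openin Hom3_topology ?W" by (rule openin_Hom3_ball)
  ultimately show "\<exists>\<W>. openin Hom3_topology \<W> \<and> \<pi> \<in> \<W> \<and>
      (\<forall>\<pi>'\<in>\<W>. three_lie_algebra \<pi>' \<longrightarrow> (\<exists>h'\<in>\<V>. three_lie_subalgebra \<pi>' h'))"
    by (intro exI[of _ ?W]) blast
qed

end
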